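(* Let $d\ge 2$, $m\ge 1$ and $1\le k_1<k_2<\dots<k_m$ be integers with $\gcd\{k_1,\dots,k_m\}=1$. Let $\mathcal{S}_c\subseteq[0,1]^m$ be the critical surface of the long-range percolation model on the rooted oriented $d$-ary tree with edge lengths $k_1,\dots,k_m$, and for $\mathbf{p}\in[0,1]^m$ let $P_Q$ denote the characteristic polynomial of the matrix $Q=Q(\mathbf{p})$ (both defined in the context). Then $$\mathcal{S}_c\subseteq\left\{\mathbf{p}\in[0,1/d^{k_1}]\times\dots\times[0,1/d^{k_m}] : P_Q(1/d)=0\right\}.$$
   Context: Model: on the rooted oriented $d$-ary tree with root $o$ (every vertex has $d$ children, edges oriented away from the root), add for each vertex $v$ and each $i\in\{1,\dots,m\}$ oriented edges of length $k_i$ from $v$ to each of its $d^{k_i}$ descendants exactly $k_i$ generations below. Given $\mathbf{p}=(p_1,\dots,p_m)\in[0,1]^m$, each edge of length $k_i$ is open with probability $p_i$, independently of all other edges; only these edges are used for percolation. An open path is a sequence of vertices connected by (oriented) open edges; $u\rightarrow v$ means there is an open path starting at $u$ and ending at $v$. Let $\mathcal{C}(v)=\{w: v\rightarrow w\}$ and $\theta(\mathbf{p})=\mathbb{P}(|\mathcal{C}(o)|=\infty)$. There is percolation at $\mathbf{p}$ if $\theta(\mathbf{p})>0$. The critical surface $\mathcal{S}_c\subseteq[0,1]^m$ is the boundary (in $[0,1]^m$) between the set of $\mathbf{p}$ for which there is percolation and the set of $\mathbf{p}$ for which there is no percolation. Matrix $Q$: rows and columns are indexed by $\{0,1\}^{k_m}\setminus\{\mathbf{0}\}$,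 where $\mathbf{0}=(0,\dots,0)$; elements are written $\mathbf{x}=(x_1,\dots,x_{k_m})$. If $y_i=x_{i+1}$ for $i=1,\dots,k_m-1$, then $$Q(\mathbf{x},\mathbf{y})=\prod_{j=1}^m(1-p_j)^{x_{k_m-k_j+1}}\ \text{ if } y_{k_m}=0,\qquad Q(\mathbf{x},\mathbf{y})=1-\prod_{j=1}^m(1-p_j)^{x_{k_m-k_j+1}}\ \text{ if } y_{k_m}=1,$$ and $Q(\mathbf{x},\mathbf{y})=0$ for all other pairs; the convention $a^0=1$ (also for $a=0$) is used. *)

theory Defs
  imports
    "HOL-Probability.Probability"
    "HOL-Library.Sublist"
    "Jordan_Normal_Form.Char_Poly"
begin

text \<open>
  A vertex of the rooted $d$-ary tree is the word of child labels read along the path from the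
  root, so the root is the empty word and the descendants of \<open>v\<close> are the words with prefix \<open>v\<close>.
\<close>

definition tree_vertices :: "nat \<Rightarrow> nat list set" where
  "tree_vertices d = lists {..<d}"

definition edges :: "nat \<Rightarrow> nat \<Rightarrow> (nat \<Rightarrow> nat) \<Rightarrow> (nat \<times> nat list \<times> nat list) set" where
  "edges d m k =
     {(i, v, w). i \<in> {1..m} \<and> v \<in> tree_vertices d \<and> w \<in> tree_vertices d \<and>
                 prefix v w \<and> length w = length v + k i}"

definition percolation_measure ::
    "nat \<Rightarrow> nat \<Rightarrow> (nat \<Rightarrow> nat) \<Rightarrow> (nat \<Rightarrow> real) \<Rightarrow> (nat \<times> nat list \<times> nat list \<Rightarrow> bool) measure" where
  "percolation_measure d m k p =
     PiM (edges d m k) (\<lambda>(i, v, w). measure_pmf (bernoulli_pmf (p i)))"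

definition open_step ::
    "nat \<Rightarrow> nat \<Rightarrow> (nat \<Rightarrow> nat) \<Rightarrow> (nat \<times> nat list \<times> nat list \<Rightarrow> bool) \<Rightarrow> (nat list \<times> nat list) set" where
  "open_step d m k \<omega> = {(v, w). \<exists>i. (i, v, w) \<in> edges d m k \<and> \<omega> (i, v, w)}"

definition cluster ::
    "nat \<Rightarrow> nat \<Rightarrow> (nat \<Rightarrow> nat) \<Rightarrow> (nat \<times> nat list \<times> nat list \<Rightarrow> bool) \<Rightarrow> nat list \<Rightarrow> nat list set" where
  "cluster d m k \<omega> v = {w. (v, w) \<in> (open_step d m k \<omega>)\<^sup>*}"

lemma infinite_cluster_measurable:
  "{\<omega> \<in> space (percolation_measure d m k p). infinite (cluster d m k \<omega> [])}
     \<in> sets (percolation_measure d m k p)"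
proof -
  let ?M = "percolation_measure d m k p"
  have step: "{\<omega> \<in> space ?M. (v, w) \<in> open_step d m k \<omega>} \<in> sets ?M" for v w
  proof -
    have edge: "{\<omega> \<in> space ?M. (i, v, w) \<in> edges d m k \<and> \<omega> (i, v, w)} \<in> sets ?M" for i
    proof (cases "(i, v, w) \<in> edges d m k")
      case True
      have "(\<lambda>\<omega>. \<omega> (i, v, w)) \<in> measurable ?M (measure_pmf (bernoulli_pmf (p i)))"
        using measurable_component_singleton[OF True,
            of "\<lambda>(i, v, w). measure_pmf (bernoulli_pmf (p i))"]
        by (simp add: percolation_measure_def)
      from measurable_sets[OF this, of "{True}"] show ?thesis
        using True by (simp add: vimage_def Int_def conj_commute)
    qed simp
    have "{\<omega> \<in> space ?M. (v, w) \<in> open_step d m k \<omega>} =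
        (\<Union>i. {\<omega> \<in> space ?M. (i, v, w) \<in> edges d m k \<and> \<omega> (i, v, w)})"
      by (auto simp: open_step_def)
    with edge show ?thesis by (auto intro!: sets.countable_UN)
  qed
  have relpow: "{\<omega> \<in> space ?M. (v, w) \<in> open_step d m k \<omega> ^^ n} \<in> sets ?M" for v w n
  proof (induction n arbitrary: w)
    case (Suc n)
    have "{\<omega> \<in> space ?M. (v, w) \<in> open_step d m k \<omega> ^^ Suc n} =
        (\<Union>u. {\<omega> \<in> space ?M. (v, u) \<in> open_step d m k \<omega> ^^ n} \<inter>
             {\<omega> \<in> space ?M. (u, w) \<in> open_step d m k \<omega>})"
      by auto
    then show ?case
      using Suc.IH step by (auto intro!: sets.countable_UN')
  qed simp
  have reach: "{\<omega> \<in> space ?M. w \<in> cluster d m k \<omega> v} \<in> sets ?M" for v w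
  proof -
    have "{\<omega> \<in> space ?M. w \<in> cluster d m k \<omega> v} =
        (\<Union>n. {\<omega> \<in> space ?M. (v, w) \<in> open_step d m k \<omega> ^^ n})"
      by (auto simp: cluster_def rtrancl_power)
    with relpow show ?thesis by (auto intro!: sets.countable_UN)
  qed
  have inf: "infinite C \<longleftrightarrow> (\<forall>F. finite F \<longrightarrow> (\<exists>w. w \<notin> F \<and> w \<in> C))" for C :: "nat list set"
    by (meson ex_new_if_finite finite_subset subsetI)
  have "{\<omega> \<in> space ?M. infinite (cluster d m k \<omega> [])} =
      space ?M \<inter> (\<Inter>F \<in> Collect finite. \<Union>w \<in> - F. {\<omega> \<in> space ?M. w \<in> cluster d m k \<omega> []})"
    by (subst inf) auto
  moreover have "(\<Inter>F \<in> Collect finite. \<Union>w \<in> - F. {\<omega> \<in> space ?M. w \<in> cluster d m k \<omega> []}) \<in> sets ?M"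
    using reach
    by (intro sets.countable_INT'' sets.countable_INT' sets.countable_UN')
       (auto intro: countable_Collect_finite)
  ultimately show ?thesis by auto
qed

definition \<theta> :: "nat \<Rightarrow> nat \<Rightarrow> (nat \<Rightarrow> nat) \<Rightarrow> (nat \<Rightarrow> real) \<Rightarrow> real" where
  "\<theta> d m k p =
     measure (percolation_measure d m k p)
       {\<omega> \<in> space (percolation_measure d m k p). infinite (cluster d m k \<omega> [])}"

text \<open>
  The cube $[0,1]^m$ is represented by the extensional functions \<open>{1..m} \<rightarrow>\<^sub>E {0..1}\<close>, which is
  the carrier of the product topology used here; the frontier is taken relative to the cube.
\<close>

definition parameter_cube :: "nat \<Rightarrow> (nat \<Rightarrow> real) topology" where
  "parameter_cube m = product_topology (\<lambda>_. top_of_set {0..1}) {1..m}"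

definition critical_surface :: "nat \<Rightarrow> nat \<Rightarrow> (nat \<Rightarrow> nat) \<Rightarrow> (nat \<Rightarrow> real) set" where
  "critical_surface d m k =
     parameter_cube m frontier_of {p \<in> topspace (parameter_cube m). \<theta> d m k p > 0}"

text \<open>
  The vector $(x_1, \dots, x_{k_m})$ is the list \<open>x\<close> with $x_i$ stored at position \<open>i - 1\<close>; in
  particular $x_{k_m - k_j + 1}$ is \<open>x ! (k m - k j)\<close>.
\<close>

definition Q_entry :: "nat \<Rightarrow> (nat \<Rightarrow> nat) \<Rightarrow> (nat \<Rightarrow> real) \<Rightarrow> nat list \<Rightarrow> nat list \<Rightarrow> real" where
  "Q_entry m k p x y =
     (let q = (\<Prod>j = 1..m. (1 - p j) ^ (x ! (k m - k j)))
      in if \<forall>i \<in> {1..<k m}. y ! (i - 1) = x ! i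
         then (if y ! (k m - 1) = 0 then q else 1 - q)
         else 0)"

text \<open>
  The rows and columns are the nonzero 0/1-vectors of length \<open>k m\<close>; the characteristic polynomial
  does not depend on how they are numbered.
\<close>

definition Q_indices :: "nat \<Rightarrow> nat list list" where
  "Q_indices n = filter (\<lambda>x. x \<noteq> replicate n 0) (List.n_lists n [0, 1])"

lemma distinct_Q_indices: "distinct (Q_indices n)"
  by (simp add: Q_indices_def distinct_n_lists)

lemma set_Q_indices:
  "set (Q_indices n) = {x. length x = n \<and> set x \<subseteq> {0, 1} \<and> x \<noteq> replicate n 0}"
  by (auto simp: Q_indices_def set_n_lists)

definition Q_matrix :: "nat \<Rightarrow> (nat \<Rightarrow> nat) \<Rightarrow> (nat \<Rightarrow> real) \<Rightarrow> real mat" where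
  "Q_matrix m k p =
     (let I = Q_indices (k m)
      in Matrix.mat (length I) (length I) (\<lambda>(a, b). Q_entry m k p (I ! a) (I ! b)))"

end

theory Submission
  imports Defs
begin

text \<open>
  Let $c_n$ be the probability that the root reaches a given vertex at depth $n$ and $b_n = d^n c_n$ the
  mean number of reached vertices at that depth; $c_n$ is a polynomial in the parameters. If $b_n > 1$
  for some $n \ge 1$, then a second moment argument gives percolation. Since edges have length at
  most $k_m$, an infinite cluster contains a vertex in each window of $k_m$ consecutive levels from
  which an infinite cluster starts, whence $\theta \le (b_{n+1} + \dots + b_{n+k_m}) \theta$, and there is
  no percolation if one of these sums is less than 1. Both conditions are open in the parameters,
  so on the critical surface all $b_n$ are at most 1, which bounds each $p_i$ because
  $p_i \le c_{k_i}$, and all window sums are at least 1.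

  The vectors $d^n \mu_n$, with $\mu_n$ the distribution at time $n$ of the chain with transition matrix
  $Q$, are then bounded. If $1/d$ were not an eigenvalue of $Q$, their sum over $n$ would converge, hence
  $b_n \to 0$, contradicting the lower bound for the window sums.
\<close>

section \<open>Independence in product spaces, a Bonferroni bound, bounded orbits of a
  matrix\<close>

text \<open>Independence amounts to the joint law of the coordinates being the product of their
  laws. Here the joint law is the product measure itself, because restricting to \<open>I\<close> is
  the identity on its space. The criterion used needs a nonempty index set.\<close>

lemma indep_vars_PiM_components:
  assumes M: "\<And>i. i \<in> I \<Longrightarrow> prob_space (M i)"
  shows "prob_space.indep_vars (PiM I M) M (\<lambda>i \<omega>. \<omega> i) I"
proof -
  interpret prob_space "PiM I M" by (rule prob_space_PiM[OF M])
  show ?thesis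
  proof (cases "I = {}")
    case True
    then show ?thesis unfolding indep_vars_def indep_sets_def by auto
  next
    case False
    have "distr (PiM I M) (PiM I M) (\<lambda>\<omega>. \<lambda>i\<in>I. \<omega> i) = distr (PiM I M) (PiM I M) (\<lambda>\<omega>. \<omega>)"
      by (rule distr_cong) (auto simp: space_PiM PiE_def extensional_restrict)
    also have "\<dots> = PiM I M" by simp
    also have "\<dots> = PiM I (\<lambda>i. distr (PiM I M) (M i) (\<lambda>\<omega>. \<omega> i))"
      by (rule PiM_cong) (simp_all add: distr_PiM_component M)
    finally show ?thesis
      using False by (subst indep_vars_iff_distr_eq_PiM') auto
  qed
qed

text \<open>An event decided by the coordinates in \<open>L\<close> is the preimage, under
  restriction to \<open>L\<close>, of a measurable set of \<open>PiM L M\<close>, and restrictions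
  to disjoint coordinate sets are independent.\<close>

lemma prob_conj_disjoint_coordinates:
  fixes I :: "'i set" and M :: "'i \<Rightarrow> 'a measure"
  defines "N \<equiv> PiM I M"
  assumes M: "\<And>i. i \<in> I \<Longrightarrow> prob_space (M i)"
    and JK: "J \<inter> K = {}" "J \<subseteq> I" "K \<subseteq> I"
    and meas: "{\<omega> \<in> space N. P \<omega>} \<in> sets N" "{\<omega> \<in> space N. Q \<omega>} \<in> sets N"
    and P: "\<And>\<omega> \<omega>'. \<omega> \<in> space N \<Longrightarrow> \<omega>' \<in> space N \<Longrightarrow> (\<And>i. i \<in> J \<Longrightarrow> \<omega> i = \<omega>' i) \<Longrightarrow> P \<omega> \<Longrightarrow> P \<omega>'"
    and Q: "\<And>\<omega> \<omega>'. \<omega> \<in> space N \<Longrightarrow> \<omega>' \<in> space N \<Longrightarrow> (\<And>i. i \<in> K \<Longrightarrow> \<omega> i = \<omega>' i) \<Longrightarrow> Q \<omega> \<Longrightarrow> Q \<omega>'"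
  shows "measure N {\<omega> \<in> space N. P \<omega> \<and> Q \<omega>} =
         measure N {\<omega> \<in> space N. P \<omega>} * measure N {\<omega> \<in> space N. Q \<omega>}"
proof -
  interpret prob_space N unfolding N_def by (rule prob_space_PiM[OF M])
  obtain \<omega>0 where \<omega>0: "\<omega>0 \<in> space N" using not_empty by blast
  \<comment> \<open>\<open>ext L\<close> fills the coordinates outside \<open>L\<close> from the
    fixed configuration \<open>\<omega>0\<close>. Events are pulled back to \<open>PiM L M\<close>
    along it.\<close>
  define ext where "ext L \<eta> = (\<lambda>i\<in>I. if i \<in> L then \<eta> i else \<omega>0 i)" for L and \<eta> :: "'i \<Rightarrow> 'a"
  have ext_meas: "ext L \<in> measurable (PiM L M) N" if "L \<subseteq> I" for L
    unfolding ext_def N_def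
  proof (rule measurable_restrict)
    fix i assume i: "i \<in> I"
    show "(\<lambda>\<eta>. if i \<in> L then \<eta> i else \<omega>0 i) \<in> measurable (PiM L M) (M i)"
      using i \<omega>0 by (cases "i \<in> L") (auto simp: N_def space_PiM intro!: measurable_const)
  qed
  have ev: "{\<omega> \<in> space N. R \<omega>} =
       (\<lambda>\<omega>. restrict (\<lambda>i. \<omega> i) L) -` (ext L -` {\<omega> \<in> space N. R \<omega>} \<inter> space (PiM L M)) \<inter> space N"
    if L: "L \<subseteq> I" and R: "\<And>\<omega> \<omega>'. \<omega> \<in> space N \<Longrightarrow> \<omega>' \<in> space N \<Longrightarrow> (\<And>i. i \<in> L \<Longrightarrow> \<omega> i = \<omega>' i) \<Longrightarrow> R \<omega> \<Longrightarrow> R \<omega>'"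
    for R L
  proof -
    have r: "restrict \<omega> L \<in> space (PiM L M)" if "\<omega> \<in> space N" for \<omega>
      using that L by (auto simp: N_def space_PiM)
    have e: "ext L (restrict \<omega> L) \<in> space N" if "\<omega> \<in> space N" for \<omega>
      using measurable_space[OF ext_meas[OF L] r[OF that]] .
    have a: "ext L (restrict \<omega> L) i = \<omega> i" if "i \<in> L" for \<omega> i
      using that L by (auto simp: ext_def)
    have "R (ext L (restrict \<omega> L)) \<longleftrightarrow> R \<omega>" if "\<omega> \<in> space N" for \<omega>
      using R[OF that e[OF that]] R[OF e[OF that] that] a by metis
    with r e show ?thesis by auto
  qed
  have "indep_vars M (\<lambda>i \<omega>. \<omega> i) I"
    unfolding N_def by (rule indep_vars_PiM_components[OF M])
  from indep_var_restrict[OF this JK]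
  have ind: "indep_var (PiM J M) (\<lambda>\<omega>. restrict (\<lambda>i. \<omega> i) J) (PiM K M) (\<lambda>\<omega>. restrict (\<lambda>i. \<omega> i) K)" .
  note sJ = measurable_sets[OF ext_meas[OF JK(2)] meas(1)]
  note sK = measurable_sets[OF ext_meas[OF JK(3)] meas(2)]
  note eP = ev[OF JK(2) P] and eQ = ev[OF JK(3) Q]
  have "{\<omega> \<in> space N. P \<omega> \<and> Q \<omega>} = {\<omega> \<in> space N. P \<omega>} \<inter> {\<omega> \<in> space N. Q \<omega>}" by auto
  moreover have "(\<lambda>\<omega>. (restrict (\<lambda>i. \<omega> i) J, restrict (\<lambda>i. \<omega> i) K)) -` (SJ \<times> SK) \<inter> space N =
      ((\<lambda>\<omega>. restrict (\<lambda>i. \<omega> i) J) -` SJ \<inter> space N) \<inter> ((\<lambda>\<omega>. restrict (\<lambda>i. \<omega> i) K) -` SK \<inter> space N)" for SJ SK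
    by auto
  ultimately show ?thesis
    using indep_varD[OF ind sJ sK] by (simp only: eP[symmetric] eQ[symmetric])
qed

text \<open>By induction on \<open>I\<close>: adding an event loses at most its overlap with the
  union so far, which subadditivity bounds by \<open>card I * \<epsilon>\<close>. The square is a
  crude bound for the number of pairs.\<close>

lemma (in finite_measure) bonferroni_lower:
  assumes "finite I" "\<And>i. i \<in> I \<Longrightarrow> A i \<in> sets M" "\<epsilon> \<ge> 0"
    and "\<And>i j. i \<in> I \<Longrightarrow> j \<in> I \<Longrightarrow> i \<noteq> j \<Longrightarrow> measure M (A i \<inter> A j) \<le> \<epsilon>"
  shows "(\<Sum>i\<in>I. measure M (A i)) \<le> measure M (\<Union>i\<in>I. A i) + real (card I) ^ 2 * \<epsilon>"
  using assms
proof (induction I rule: finite_induct)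
  case (insert x I)
  have [measurable]: "A i \<in> sets M" if "i \<in> insert x I" for i using insert.prems(1)[OF that] .
  have U: "(\<Union>i\<in>I. A i) \<in> sets M" "A x \<in> sets M" using insert by auto
  have "measure M ((\<Union>i\<in>I. A i) \<inter> A x) = measure M (\<Union>i\<in>I. A i \<inter> A x)"
    by (simp add: Int_UN_distrib2)
  also have "\<dots> \<le> (\<Sum>i\<in>I. measure M (A i \<inter> A x))"
    using insert by (intro finite_measure_subadditive_finite) auto
  also have "\<dots> \<le> (\<Sum>i\<in>I. \<epsilon>)"
    using insert by (intro sum_mono) auto
  finally have int: "measure M ((\<Union>i\<in>I. A i) \<inter> A x) \<le> real (card I) * \<epsilon>" by simp
  have "measure M ((\<Union>i\<in>I. A i) \<union> A x) = measure M (\<Union>i\<in>I. A i) + measure M (A x - (\<Union>i\<in>I. A i))"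
    using U by (rule finite_measure_Union')
  also have "measure M (A x - (\<Union>i\<in>I. A i)) = measure M (A x) - measure M (A x \<inter> (\<Union>i\<in>I. A i))"
    using U by (intro finite_measure_Diff')
  finally have "measure M (\<Union>i\<in>I. A i) + measure M (A x) \<le> measure M (\<Union>i\<in>insert x I. A i) + real (card I) * \<epsilon>"
    using int by (simp add: Int_commute Un_commute)
  moreover have "(\<Sum>i\<in>I. measure M (A i)) \<le> measure M (\<Union>i\<in>I. A i) + real (card I) ^ 2 * \<epsilon>"
    using insert by auto
  moreover have "real (card I) * \<epsilon> + real (card I) ^ 2 * \<epsilon> \<le> real (card (insert x I)) ^ 2 * \<epsilon>"
    using insert.hyps \<open>\<epsilon> \<ge> 0\<close> by (simp add: power2_eq_square algebra_simps)
  ultimately show ?case using insert.hyps by simp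
qed simp

text \<open>
  Summing the recursion over \<open>t < n\<close> gives \<open>S\<^sub>n (A - c I) = c (v\<^sub>n - v\<^sub>0)\<close>
  for the partial sums \<open>S\<^sub>n\<close>, so these are bounded as soon as \<open>A - c I\<close> is invertible.
\<close>

lemma bounded_orbit_tendsto_0:
  fixes A :: "real mat" and v :: "nat \<Rightarrow> nat \<Rightarrow> real"
  assumes A: "A \<in> carrier_mat n n" and nonroot: "poly (char_poly A) c \<noteq> 0"
    and rec: "\<And>t i. i < n \<Longrightarrow> c * v (Suc t) i = (\<Sum>j<n. v t j * A $$ (j, i))"
    and nonneg: "\<And>t i. i < n \<Longrightarrow> 0 \<le> v t i" and bound: "\<And>t i. i < n \<Longrightarrow> v t i \<le> C"
    and i: "i < n"
  shows "(\<lambda>t. v t i) \<longlonglongrightarrow> 0"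
proof -
  define D where "D = char_matrix A c"
  have D: "D \<in> carrier_mat n n" using A by (simp add: D_def)
  have "det D \<noteq> 0"
    using nonroot eigenvalue_root_char_poly[OF A] eigenvalue_det[OF A] by (simp add: D_def)
  from det_non_zero_imp_unit[OF D this, of "()"] obtain B
    where B: "B \<in> carrier_mat n n" and DB: "D * B = 1\<^sub>m n"
    by (auto simp: Units_def ring_mat_def)
  have D_entry: "D $$ (j, l) = A $$ (j, l) - (if j = l then c else 0)" if "j < n" "l < n" for j l
    using that A by (auto simp: D_def char_matrix_def)
  define S where "S N j = (\<Sum>t<N. v t j)" for N j
  have SD: "(\<Sum>j<n. S N j * D $$ (j, l)) = c * (v N l - v 0 l)" if l: "l < n" for N l
  proof -
    have "(\<Sum>j<n. S N j * D $$ (j, l)) = (\<Sum>j<n. S N j * A $$ (j, l)) - (\<Sum>j<n. S N j * (if j = l then c else 0))"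
      using l by (simp add: D_entry right_diff_distrib sum_subtractf)
    also have "(\<Sum>j<n. S N j * (if j = l then c else 0)) = c * S N l"
      using l by (simp add: if_distrib sum.delta cong: if_cong)
    also have "(\<Sum>j<n. S N j * A $$ (j, l)) = (\<Sum>t<N. \<Sum>j<n. v t j * A $$ (j, l))"
      unfolding S_def sum_distrib_right by (rule sum.swap)
    also have "\<dots> = c * (\<Sum>t<N. v (Suc t) l)"
      using l by (simp add: rec[symmetric] sum_distrib_left)
    also have "(\<Sum>t<N. v (Suc t) l) = S N l + v N l - v 0 l"
      unfolding S_def by (induction N) auto
    finally show ?thesis by (simp add: algebra_simps)
  qed
  \<comment> \<open>The right inverse \<open>B\<close> recovers \<open>S N\<close> from the row
    vector \<open>S N * D\<close>, so the partial sum is expressed through the bounded entries of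
    \<open>v N\<close> and \<open>v 0\<close> alone.\<close>
  have S_eq: "S N i = (\<Sum>l<n. (c * (v N l - v 0 l)) * B $$ (l, i))" for N
  proof -
    have "S N i = (\<Sum>j<n. S N j * (if j = i then 1 else 0))"
      using i by (simp add: if_distrib sum.delta cong: if_cong)
    also have "\<dots> = (\<Sum>j<n. S N j * (\<Sum>l<n. D $$ (j, l) * B $$ (l, i)))"
    proof (rule sum.cong)
      fix j assume "j \<in> {..<n}"
      then have "(D * B) $$ (j, i) = (\<Sum>l<n. D $$ (j, l) * B $$ (l, i))"
        using i D B by (simp add: scalar_prod_def lessThan_atLeast0)
      moreover have "(D * B) $$ (j, i) = (if j = i then 1 else 0)"
        using i \<open>j \<in> {..<n}\<close> by (simp add: DB)
      ultimately show "S N j * (if j = i then 1 else 0) = S N j * (\<Sum>l<n. D $$ (j, l) * B $$ (l, i))"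
        by simp
    qed simp
    also have "\<dots> = (\<Sum>l<n. (\<Sum>j<n. S N j * D $$ (j, l)) * B $$ (l, i))"
      unfolding sum_distrib_left sum_distrib_right by (subst sum.swap) (simp add: mult.assoc)
    also have "\<dots> = (\<Sum>l<n. (c * (v N l - v 0 l)) * B $$ (l, i))"
      by (intro sum.cong) (simp_all add: SD)
    finally show ?thesis .
  qed
  have "S N i \<le> (\<Sum>l<n. (\<bar>c\<bar> * C) * \<bar>B $$ (l, i)\<bar>)" for N
    unfolding S_eq
  proof (rule sum_mono)
    fix l assume "l \<in> {..<n}"
    then have "\<bar>v N l - v 0 l\<bar> \<le> C"
      using nonneg[of l N] nonneg[of l 0] bound[of l N] bound[of l 0] by auto
    then have "\<bar>c * (v N l - v 0 l) * B $$ (l, i)\<bar> \<le> (\<bar>c\<bar> * C) * \<bar>B $$ (l, i)\<bar>"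
      unfolding abs_mult by (intro mult_mono) auto
    then show "c * (v N l - v 0 l) * B $$ (l, i) \<le> (\<bar>c\<bar> * C) * \<bar>B $$ (l, i)\<bar>" by linarith
  qed
  then have "(\<Sum>t\<le>N. v t i) \<le> (\<Sum>l<n. (\<bar>c\<bar> * C) * \<bar>B $$ (l, i)\<bar>)" for N
    unfolding S_def lessThan_Suc_atMost[symmetric] .
  then have "summable (\<lambda>t. v t i)"
    by (rule bounded_imp_summable[OF nonneg[OF i]])
  then show ?thesis by (rule summable_LIMSEQ_zero)
qed

section \<open>Open paths in the tree\<close>

locale long_range_tree =
  fixes d m :: nat and k :: "nat \<Rightarrow> nat"
  assumes d_ge_2: "d \<ge> 2" and m_ge_1: "m \<ge> 1" and k_1: "k 1 \<ge> 1" and k_mono: "strict_mono_on {1..m} k"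
begin

definition reach :: "(nat \<times> nat list \<times> nat list \<Rightarrow> bool) \<Rightarrow> nat list \<Rightarrow> nat list \<Rightarrow> bool" where
  "reach \<omega> v w \<longleftrightarrow> (v, w) \<in> (open_step d m k \<omega>)\<^sup>*"

abbreviation "T \<equiv> tree_vertices d"
abbreviation "K \<equiv> k m"

lemma T_iff: "v \<in> T \<longleftrightarrow> set v \<subseteq> {..<d}"
  by (auto simp: tree_vertices_def in_lists_conv_set)

lemma k_ge_1: "i \<in> {1..m} \<Longrightarrow> k i \<ge> 1"
  using strict_mono_on_leD[OF k_mono, of 1 i] k_1 by auto

lemma k_le_K: "i \<in> {1..m} \<Longrightarrow> k i \<le> K"
  using strict_mono_on_leD[OF k_mono, of i m] by auto

lemma K_ge_1: "K \<ge> 1"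
  using k_ge_1[of m] m_ge_1 by simp

lemma edgesD:
  assumes "(i, v, w) \<in> edges d m k"
  shows "i \<in> {1..m}" "v \<in> T" "w \<in> T" "prefix v w" "length w = length v + k i" "v = take (length w - k i) w"
  using assms by (auto simp: edges_def prefix_def)

text \<open>A vertex has at most one incoming edge of each length, as its ancestor at a given
  distance is unique.\<close>

lemma edges_iff_take:
  assumes "w \<in> T"
  shows "(i, v, w) \<in> edges d m k \<longleftrightarrow> i \<in> {1..m} \<and> k i \<le> length w \<and> v = take (length w - k i) w"
proof
  assume "(i, v, w) \<in> edges d m k"
  note e = edgesD[OF this]
  show "i \<in> {1..m} \<and> k i \<le> length w \<and> v = take (length w - k i) w"
    using e(1,6) e(5) by (intro conjI) (assumption | linarith)+
next
  assume "i \<in> {1..m} \<and> k i \<le> length w \<and> v = take (length w - k i) w"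
  then show "(i, v, w) \<in> edges d m k"
    using assms set_take_subset[of "length w - k i" w]
    by (auto simp: edges_def T_iff take_is_prefix min_def)
qed

lemma open_stepD:
  assumes "(v, w) \<in> open_step d m k \<omega>"
  shows "v \<in> T" "w \<in> T" "prefix v w" "length v < length w" "length w \<le> length v + K"
proof -
  obtain i where e: "(i, v, w) \<in> edges d m k" using assms by (auto simp: open_step_def)
  note i = edgesD[OF e]
  show "v \<in> T" "w \<in> T" "prefix v w" "length v < length w" "length w \<le> length v + K"
    using i(2-5) k_ge_1[OF i(1)] k_le_K[OF i(1)] by simp_all
qed

lemma reach_prefix: "reach \<omega> v w \<Longrightarrow> prefix v w"
  unfolding reach_def
  by (induction rule: rtrancl_induct) (auto dest: open_stepD(3) intro: prefix_order.trans)

lemma reach_T: "reach \<omega> v w \<Longrightarrow> v \<in> T \<Longrightarrow> w \<in> T"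
  unfolding reach_def by (induction rule: rtrancl_induct) (auto dest: open_stepD)

lemma reach_refl [simp]: "reach \<omega> v v"
  by (simp add: reach_def)

lemma reach_trans: "reach \<omega> u v \<Longrightarrow> reach \<omega> v w \<Longrightarrow> reach \<omega> u w"
  unfolding reach_def by (rule rtrancl_trans)

text \<open>Vertices on an open path from \<open>v\<close> to \<open>w\<close> are prefixes of
  \<open>w\<close> extending \<open>v\<close>, so no other edge matters. This locality is what
  yields independence later.\<close>

lemma reach_cong:
  assumes "reach \<omega> v w"
    and "\<And>i a b. (i, a, b) \<in> edges d m k \<Longrightarrow> prefix v a \<Longrightarrow> prefix b w \<Longrightarrow> \<omega> (i, a, b) = \<omega>' (i, a, b)"
  shows "reach \<omega>' v w"
proof -
  have "prefix u w \<Longrightarrow> reach \<omega>' v u" if "(v, u) \<in> (open_step d m k \<omega>)\<^sup>*" for u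
    using that
  proof (induction rule: rtrancl_induct)
    case (step a b)
    from step.hyps have "prefix v a" by (simp add: reach_prefix reach_def)
    moreover from step.hyps obtain i where i: "(i, a, b) \<in> edges d m k" "\<omega> (i, a, b)"
      by (auto simp: open_step_def)
    ultimately have "\<omega>' (i, a, b)" using assms(2) step.prems by blast
    with i have "(a, b) \<in> open_step d m k \<omega>'" by (auto simp: open_step_def)
    moreover have "reach \<omega>' v a"
      using step edgesD(4)[OF i(1)] prefix_order.trans by blast
    ultimately show ?case by (auto simp: reach_def)
  qed simp
  from this[of w] assms(1) show ?thesis by (simp add: reach_def)
qed

section \<open>Passing to the subtree of a vertex\<close>

text \<open>The configuration seen from \<open>v\<close>, moved to the root. Restricting it to the
  edge set makes it a point of the space of configurations.\<close>

definition tree_shift :: "nat list \<Rightarrow> (nat \<times> nat list \<times> nat list \<Rightarrow> bool) \<Rightarrow> nat \<times> nat list \<times> nat list \<Rightarrow> bool" where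
  "tree_shift v \<omega> = (\<lambda>e\<in>edges d m k. \<omega> (fst e, v @ fst (snd e), v @ snd (snd e)))"

lemma append_T_iff: "v @ a \<in> T \<longleftrightarrow> v \<in> T \<and> a \<in> T"
  by (simp add: T_iff)

lemma edges_append_iff:
  "v \<in> T \<Longrightarrow> (i, v @ a, v @ b) \<in> edges d m k \<longleftrightarrow> (i, a, b) \<in> edges d m k"
  by (auto simp: edges_def append_T_iff)

lemma open_step_tree_shift:
  "v \<in> T \<Longrightarrow> (a, b) \<in> open_step d m k (tree_shift v \<omega>) \<longleftrightarrow> (v @ a, v @ b) \<in> open_step d m k \<omega>"
  by (auto simp: open_step_def tree_shift_def edges_append_iff)

lemma reach_tree_shift:
  assumes v: "v \<in> T"
  shows "reach (tree_shift v \<omega>) a b \<longleftrightarrow> reach \<omega> (v @ a) (v @ b)"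
proof
  assume "reach (tree_shift v \<omega>) a b"
  then show "reach \<omega> (v @ a) (v @ b)"
    unfolding reach_def
  proof (induction rule: rtrancl_induct)
    case (step y z)
    then show ?case by (simp add: open_step_tree_shift v rtrancl.rtrancl_into_rtrancl)
  qed simp
next
  \<comment> \<open>Steps only extend words, so every vertex reached from an extension of
    \<open>v\<close> is again an extension of \<open>v\<close>.\<close>
  have "\<exists>b. c = v @ b \<and> reach (tree_shift v \<omega>) a b" if "(v @ a, c) \<in> (open_step d m k \<omega>)\<^sup>*" for c
    using that
  proof (induction rule: rtrancl_induct)
    case (step y z)
    then obtain b where b: "y = v @ b" "reach (tree_shift v \<omega>) a b" by auto
    from open_stepD(3)[OF step.hyps(2)] b obtain b' where b': "z = v @ b'"
      by (auto simp: prefix_def)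
    from step.hyps(2) have "(b, b') \<in> open_step d m k (tree_shift v \<omega>)"
      by (simp add: open_step_tree_shift v b b')
    with b b' show ?case by (auto simp: reach_def)
  qed simp
  moreover assume "reach \<omega> (v @ a) (v @ b)"
  ultimately show "reach (tree_shift v \<omega>) a b" by (auto simp: reach_def)
qed

text \<open>The first vertex of the path deeper than \<open>N\<close> will do: its predecessor has
  depth at most \<open>N\<close>, and an edge spans at most \<open>K\<close> levels.\<close>

lemma reach_window:
  assumes "reach \<omega> u w" "length u \<le> N" "N < length w"
  obtains v where "reach \<omega> u v" "reach \<omega> v w" "N < length v" "length v \<le> N + K"
proof -
  have "N < length w \<Longrightarrow> \<exists>v. reach \<omega> u v \<and> reach \<omega> v w \<and> N < length v \<and> length v \<le> N + K"
    using assms(1) unfolding reach_def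
  proof (induction rule: rtrancl_induct)
    case (step y z)
    show ?case
    proof (cases "N < length y")
      case True
      with step show ?thesis by (meson rtrancl.rtrancl_into_rtrancl)
    next
      case False
      with open_stepD(5)[OF step.hyps(2)] step show ?thesis
        by (intro exI[of _ z]) auto
    qed
  qed (use assms(2) in simp)
  with assms(3) that show ?thesis by blast
qed

text \<open>Prepares the passage to a Markov chain: whether \<open>w\<close> is reached depends on
  its ancestors and on one edge per length.\<close>

lemma reach_last_step:
  assumes w: "w \<in> T" "w \<noteq> []"
  shows "reach \<omega> [] w \<longleftrightarrow>
    (\<exists>i\<in>{1..m}. k i \<le> length w \<and> reach \<omega> [] (take (length w - k i) w) \<and> \<omega> (i, take (length w - k i) w, w))"
proof
  assume "reach \<omega> [] w"
  with w(2) obtain v where v: "reach \<omega> [] v" "(v, w) \<in> open_step d m k \<omega>"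
    unfolding reach_def by (metis rtranclE)
  then obtain i where "(i, v, w) \<in> edges d m k" "\<omega> (i, v, w)" by (auto simp: open_step_def)
  with v edges_iff_take[OF w(1)]
  show "\<exists>i\<in>{1..m}. k i \<le> length w \<and> reach \<omega> [] (take (length w - k i) w) \<and> \<omega> (i, take (length w - k i) w, w)"
    by auto
next
  assume "\<exists>i\<in>{1..m}. k i \<le> length w \<and> reach \<omega> [] (take (length w - k i) w) \<and> \<omega> (i, take (length w - k i) w, w)"
  then obtain i where i: "i\<in>{1..m}" "k i \<le> length w" "reach \<omega> [] (take (length w - k i) w)" "\<omega> (i, take (length w - k i) w, w)"
    by blast
  then have "(take (length w - k i) w, w) \<in> open_step d m k \<omega>"
    using edges_iff_take[OF w(1)] by (auto simp: open_step_def)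
  with i(3) show "reach \<omega> [] w" by (auto simp: reach_def)
qed

end

section \<open>Independence and translation invariance\<close>

locale long_range_percolation = long_range_tree +
  fixes p :: "nat \<Rightarrow> real"
  assumes p_01: "\<And>i. i \<in> {1..m} \<Longrightarrow> p i \<in> {0..1}"
begin

abbreviation "E \<equiv> edges d m k"
abbreviation "N \<equiv> percolation_measure d m k p"

sublocale N: prob_space N
  unfolding percolation_measure_def
  by (rule prob_space_PiM) (auto simp: case_prod_unfold intro: measure_pmf.prob_space_axioms)

lemma pred_edge [measurable (raw)]: "e \<in> E \<Longrightarrow> Measurable.pred N (\<lambda>\<omega>. \<omega> e)"
proof -
  assume e: "e \<in> E"
  have "(\<lambda>\<omega>. \<omega> e) \<in> measurable N (case e of (i, v, w) \<Rightarrow> measure_pmf (bernoulli_pmf (p i)))"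
    unfolding percolation_measure_def using e by (rule measurable_component_singleton)
  then show ?thesis by (simp add: case_prod_unfold)
qed

lemma pred_open_step [measurable]: "Measurable.pred N (\<lambda>\<omega>. (v, w) \<in> open_step d m k \<omega>)"
proof -
  have "Measurable.pred N (\<lambda>\<omega>. (i, v, w) \<in> E \<and> \<omega> (i, v, w))" for i
    by (cases "(i, v, w) \<in> E") simp_all
  then show ?thesis unfolding open_step_def by simp
qed

lemma pred_reach [measurable]: "Measurable.pred N (\<lambda>\<omega>. reach \<omega> v w)"
proof -
  have "Measurable.pred N (\<lambda>\<omega>. (v, w) \<in> open_step d m k \<omega> ^^ n)" for n
  proof (induction n arbitrary: w)
    case (Suc n)
    note Suc.IH [measurable]
    have "(\<lambda>\<omega>. (v, w) \<in> open_step d m k \<omega> ^^ Suc n) =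
        (\<lambda>\<omega>. \<exists>u. (v, u) \<in> open_step d m k \<omega> ^^ n \<and> (u, w) \<in> open_step d m k \<omega>)"
      by auto
    then show ?case by simp
  qed simp
  then show ?thesis unfolding reach_def rtrancl_power by simp
qed

lemma prob_conj_disjoint_edges:
  assumes "J \<inter> J' = {}" "J \<subseteq> E" "J' \<subseteq> E"
    and [measurable]: "Measurable.pred N P" "Measurable.pred N Q"
    and "\<And>\<omega> \<omega>'. (\<And>e. e \<in> J \<Longrightarrow> \<omega> e = \<omega>' e) \<Longrightarrow> P \<omega> \<Longrightarrow> P \<omega>'"
    and "\<And>\<omega> \<omega>'. (\<And>e. e \<in> J' \<Longrightarrow> \<omega> e = \<omega>' e) \<Longrightarrow> Q \<omega> \<Longrightarrow> Q \<omega>'"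
  shows "\<P>(\<omega> in N. P \<omega> \<and> Q \<omega>) = \<P>(\<omega> in N. P \<omega>) * \<P>(\<omega> in N. Q \<omega>)"
  unfolding percolation_measure_def
proof (rule prob_conj_disjoint_coordinates[OF _ assms(1-3)], goal_cases)
  case 1
  then show ?case by (auto simp: case_prod_unfold intro: measure_pmf.prob_space_axioms)
next
  case (4 \<omega> \<omega>')
  then show ?case using assms(6) by blast
next
  case (5 \<omega> \<omega>')
  then show ?case using assms(7) by blast
qed (use assms(4,5) in \<open>simp_all add: percolation_measure_def pred_def\<close>)

text \<open>Prepending \<open>v\<close> maps edges injectively to edges and keeps the index
  \<open>i\<close>, hence the edge probability. Reindexing a product measure along such a map gives
  the same measure.\<close>

lemma distr_tree_shift:
  assumes v: "v \<in> T"
  shows "distr N N (tree_shift v) = N"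
proof -
  let ?F = "\<lambda>(i, v :: nat list, w :: nat list). measure_pmf (bernoulli_pmf (p i))"
  define f where "f e = (fst e, v @ fst (snd e), v @ snd (snd e))" for e :: "nat \<times> nat list \<times> nat list"
  have f: "f ` E \<subseteq> E" "inj_on f E"
    using v by (auto simp: f_def edges_append_iff inj_on_def)
  have F: "?F (f e) = ?F e" for e by (simp add: f_def case_prod_unfold)
  have N: "N = PiM E (\<lambda>e. ?F (f e))" unfolding percolation_measure_def F ..
  have "distr (PiM E ?F) (PiM E (\<lambda>e. ?F (f e))) (\<lambda>\<omega>. \<lambda>e\<in>E. \<omega> (f e)) = PiM E (\<lambda>e. ?F (f e))"
    by (rule distr_PiM_reindex)
       (use f in \<open>auto simp: case_prod_unfold intro: measure_pmf.prob_space_axioms\<close>)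
  then show ?thesis
    unfolding tree_shift_def f_def[symmetric] F percolation_measure_def .
qed

lemma measurable_tree_shift [measurable (raw)]:
  assumes v: "v \<in> T"
  shows "tree_shift v \<in> measurable N N"
proof -
  have "(\<lambda>\<omega>. \<lambda>e\<in>E. \<omega> (fst e, v @ fst (snd e), v @ snd (snd e))) \<in> measurable N (PiM E (\<lambda>e. count_space UNIV))"
  proof (rule measurable_restrict)
    fix e assume "e \<in> E"
    then have "(fst e, v @ fst (snd e), v @ snd (snd e)) \<in> E"
      using v by (cases e) (simp add: edges_append_iff)
    from pred_edge[OF this]
    show "(\<lambda>\<omega>. \<omega> (fst e, v @ fst (snd e), v @ snd (snd e))) \<in> measurable N (count_space UNIV)" .
  qed
  also have "measurable N (PiM E (\<lambda>e. count_space UNIV)) = measurable N N"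
    unfolding percolation_measure_def
    by (intro measurable_cong_sets refl sets_PiM_cong) (simp add: case_prod_unfold)
  finally show ?thesis unfolding tree_shift_def .
qed

lemma prob_tree_shift:
  assumes v: "v \<in> T" and [measurable]: "Measurable.pred N P"
  shows "\<P>(\<omega> in N. P (tree_shift v \<omega>)) = \<P>(\<omega> in N. P \<omega>)"
proof -
  have "\<P>(\<omega> in N. P \<omega>) = \<P>(\<omega> in distr N N (tree_shift v). P \<omega>)"
    by (simp add: distr_tree_shift v)
  also have "\<dots> = measure N (tree_shift v -` {\<omega> \<in> space N. P \<omega>} \<inter> space N)"
    using measurable_tree_shift[OF v] by (subst measure_distr) auto
  also have "tree_shift v -` {\<omega> \<in> space N. P \<omega>} \<inter> space N = {\<omega> \<in> space N. P (tree_shift v \<omega>)}"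
    using measurable_space[OF measurable_tree_shift[OF v]] by auto
  finally show ?thesis ..
qed

lemma pred_tree_shift [measurable (raw)]:
  assumes "v \<in> T" "Measurable.pred N P"
  shows "Measurable.pred N (\<lambda>\<omega>. P (tree_shift v \<omega>))"
  using measurable_compose[OF measurable_tree_shift[OF assms(1)] assms(2)] .

section \<open>Independence of disjoint parts of the tree\<close>

definition subtree_edges :: "nat list \<Rightarrow> (nat \<times> nat list \<times> nat list) set" where
  "subtree_edges v = {(i, a, b) \<in> E. prefix v a}"

lemma tree_shift_cong:
  assumes v: "v \<in> T" and eq: "\<And>e. e \<in> subtree_edges v \<Longrightarrow> \<omega> e = \<omega>' e"
  shows "tree_shift v \<omega> = tree_shift v \<omega>'"
proof -
  have "\<omega> (fst e, v @ fst (snd e), v @ snd (snd e)) = \<omega>' (fst e, v @ fst (snd e), v @ snd (snd e))"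
    if "e \<in> E" for e
    using that v by (intro eq) (cases e, simp add: subtree_edges_def edges_append_iff)
  then show ?thesis unfolding tree_shift_def by (rule restrict_ext)
qed

text \<open>Reaching \<open>v\<close> involves only edges ending at a prefix of \<open>v\<close>,
  the shifted configuration only edges starting at an extension of \<open>v\<close>. Edges have
  positive length, so no edge is of both kinds.\<close>

lemma prob_reach_tree_shift:
  assumes v: "v \<in> T" and [measurable]: "Measurable.pred N P"
  shows "\<P>(\<omega> in N. reach \<omega> [] v \<and> P (tree_shift v \<omega>)) = \<P>(\<omega> in N. reach \<omega> [] v) * \<P>(\<omega> in N. P \<omega>)"
proof -
  let ?J = "{(i, a, b) \<in> E. prefix b v}"
  have "\<P>(\<omega> in N. reach \<omega> [] v \<and> P (tree_shift v \<omega>)) =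
      \<P>(\<omega> in N. reach \<omega> [] v) * \<P>(\<omega> in N. P (tree_shift v \<omega>))"
  proof (rule prob_conj_disjoint_edges[of ?J "subtree_edges v"])
    show "?J \<inter> subtree_edges v = {}"
      using k_ge_1 by (fastforce simp: subtree_edges_def edges_def dest: prefix_length_le)
    show "reach \<omega>' [] v" if "\<And>e. e \<in> ?J \<Longrightarrow> \<omega> e = \<omega>' e" "reach \<omega> [] v" for \<omega> \<omega>'
      by (rule reach_cong[OF that(2)]) (use that(1) in auto)
    show "P (tree_shift v \<omega>')" if "\<And>e. e \<in> subtree_edges v \<Longrightarrow> \<omega> e = \<omega>' e" "P (tree_shift v \<omega>)" for \<omega> \<omega>'
      using tree_shift_cong[OF v that(1)] that(2) by simp
    show "Measurable.pred N (\<lambda>\<omega>. P (tree_shift v \<omega>))" using v by measurable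
  qed (auto simp: subtree_edges_def)
  with prob_tree_shift[OF assms] show ?thesis by simp
qed

text \<open>Distinct vertices of equal depth have no common descendant, so their subtrees share no
  edge.\<close>

lemma prob_two_tree_shifts:
  assumes vw: "v \<in> T" "w \<in> T" "v \<noteq> w" "length v = length w" and [measurable]: "Measurable.pred N P"
  shows "\<P>(\<omega> in N. P (tree_shift v \<omega>) \<and> P (tree_shift w \<omega>)) = \<P>(\<omega> in N. P \<omega>)\<^sup>2"
proof -
  have "\<P>(\<omega> in N. P (tree_shift v \<omega>) \<and> P (tree_shift w \<omega>)) =
      \<P>(\<omega> in N. P (tree_shift v \<omega>)) * \<P>(\<omega> in N. P (tree_shift w \<omega>))"
  proof (rule prob_conj_disjoint_edges[of "subtree_edges v" "subtree_edges w"])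
    show "subtree_edges v \<inter> subtree_edges w = {}"
      using vw by (auto simp: subtree_edges_def prefix_def)
    show "P (tree_shift v \<omega>')" if "\<And>e. e \<in> subtree_edges v \<Longrightarrow> \<omega> e = \<omega>' e" "P (tree_shift v \<omega>)" for \<omega> \<omega>'
      using tree_shift_cong[OF vw(1) that(1)] that(2) by simp
    show "P (tree_shift w \<omega>')" if "\<And>e. e \<in> subtree_edges w \<Longrightarrow> \<omega> e = \<omega>' e" "P (tree_shift w \<omega>)" for \<omega> \<omega>'
      using tree_shift_cong[OF vw(2) that(1)] that(2) by simp
    show "Measurable.pred N (\<lambda>\<omega>. P (tree_shift v \<omega>))" "Measurable.pred N (\<lambda>\<omega>. P (tree_shift w \<omega>))"
      using vw by measurable
  qed (auto simp: subtree_edges_def)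
  with prob_tree_shift vw(1,2) assms(5) show ?thesis by (simp add: power2_eq_square)
qed

lemma prob_all_closed:
  assumes J: "finite J" "J \<subseteq> E"
  shows "\<P>(\<omega> in N. \<forall>e\<in>J. \<not> \<omega> e) = (\<Prod>(i, v, w)\<in>J. 1 - p i)"
proof -
  let ?F = "\<lambda>(i, v :: nat list, w :: nat list). measure_pmf (bernoulli_pmf (p i))"
  interpret F: product_prob_space ?F E
    by (rule product_prob_spaceI) (simp add: case_prod_unfold measure_pmf.prob_space_axioms)
  have "emeasure (PiM E ?F) {\<omega> \<in> space (PiM E ?F). \<forall>e\<in>J. \<omega> e \<in> {False}} = (\<Prod>e\<in>J. emeasure (?F e) {False})"
    using J by (intro F.emeasure_PiM_Collect) (auto simp: case_prod_unfold)
  also have "\<dots> = (\<Prod>e\<in>J. ennreal (1 - p (fst e)))"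
  proof (rule prod.cong)
    fix e assume "e \<in> J"
    then have "fst e \<in> {1..m}" using J by (cases e) (auto simp: edges_def)
    then show "emeasure (?F e) {False} = ennreal (1 - p (fst e))"
      using p_01 by (simp add: case_prod_unfold emeasure_pmf_single)
  qed simp
  also have "\<dots> = ennreal (\<Prod>e\<in>J. 1 - p (fst e))"
    using J p_01 by (intro prod_ennreal) (auto simp: edges_def)
  finally have "emeasure N {\<omega> \<in> space N. \<forall>e\<in>J. \<not> \<omega> e} = ennreal (\<Prod>e\<in>J. 1 - p (fst e))"
    by (simp add: percolation_measure_def)
  moreover have "(\<Prod>e\<in>J. 1 - p (fst e)) \<ge> 0"
    using J p_01 by (intro prod_nonneg) (auto simp: edges_def)
  ultimately show ?thesis
    by (simp add: measure_def case_prod_unfold)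
qed

end

section \<open>Connection probabilities and the matrix $Q$\<close>

fun occ :: "nat \<Rightarrow> (nat \<Rightarrow> nat) \<Rightarrow> (nat \<Rightarrow> real) \<Rightarrow> nat \<Rightarrow> nat list \<Rightarrow> real" where
  "occ m k p 0 y = of_bool (y = replicate (k m - 1) 0 @ [1])"
| "occ m k p (Suc n) y = (\<Sum>x\<in>set (Q_indices (k m)). occ m k p n x * Q_entry m k p x y)"

text \<open>
  \<open>occ m k p n y\<close> is the probability that the chain started at $(0, \dots, 0, 1)$ is in state \<open>y\<close> after
  \<open>n\<close> steps, and \<open>conn m k p n\<close> the probability that the root reaches a given vertex at depth \<open>n\<close>.
\<close>

definition conn :: "nat \<Rightarrow> (nat \<Rightarrow> nat) \<Rightarrow> (nat \<Rightarrow> real) \<Rightarrow> nat \<Rightarrow> real" where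
  "conn m k p n = (\<Sum>y\<in>{y \<in> set (Q_indices (k m)). y ! (k m - 1) = 1}. occ m k p n y)"

context long_range_percolation
begin

text \<open>
  Entry \<open>j\<close> of the state records whether the ancestor of \<open>w\<close> lying \<open>K - 1 - j\<close> generations above
  it is reached from the root, so the last entry concerns \<open>w\<close> itself. Along a ray these states form
  the Markov chain with transition matrix $Q$, killed on entering the zero vector.
\<close>

definition state :: "(nat \<times> nat list \<times> nat list \<Rightarrow> bool) \<Rightarrow> nat list \<Rightarrow> nat list" where
  "state \<omega> w = map (\<lambda>j. of_bool (K - 1 - j \<le> length w \<and> reach \<omega> [] (take (length w - (K - 1 - j)) w))) [0..<K]"

lemma length_state [simp]: "length (state \<omega> w) = K"
  by (simp add: state_def)

lemma state_nth:
  "j < K \<Longrightarrow> state \<omega> w ! j = of_bool (K - 1 - j \<le> length w \<and> reach \<omega> [] (take (length w - (K - 1 - j)) w))"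
  by (simp add: state_def)

text \<open>Only the last entry refers to a vertex of the tree. The guard in \<open>state\<close>
  reads ancestors above the root as 0, whereas truncated subtraction alone would read them as the
  root.\<close>

lemma state_Nil: "state \<omega> [] = replicate (K - 1) 0 @ [1]"
  using K_ge_1 by (intro nth_equalityI) (auto simp: state_nth nth_append)

lemma state_last: "state \<omega> w ! (K - Suc 0) = of_bool (reach \<omega> [] w)"
  using K_ge_1 by (simp add: state_nth)

text \<open>Passing to a child shifts the window of recorded ancestors by one, since an ancestor of
  \<open>w\<close> is one generation further from the child.\<close>

lemma state_snoc_nth:
  assumes j: "j < K - Suc 0"
  shows "state \<omega> (w @ [a]) ! j = state \<omega> w ! Suc j"
proof -
  have "Suc (Suc j) \<le> K" using j by linarith
  \<comment> \<open>Writing \<open>K\<close> as a sum removes the truncated subtractions.\<close>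
  then obtain g where g: "K = Suc (Suc j) + g" using le_Suc_ex by blast
  show ?thesis
    using j by (simp add: state_nth) (simp add: g)
qed

lemma pred_state [measurable]: "Measurable.pred N (\<lambda>\<omega>. state \<omega> w = y)"
proof -
  have "(\<lambda>\<omega>. state \<omega> w = y) = (\<lambda>\<omega>. length y = K \<and> (\<forall>j\<in>{..<K}. y ! j = of_bool (K - 1 - j \<le> length w \<and> reach \<omega> [] (take (length w - (K - 1 - j)) w))))"
    by (auto simp: list_eq_iff_nth_eq state_nth)
  also have "Measurable.pred N \<dots>" by measurable
  finally show ?thesis .
qed

lemma state_in_indices: "state \<omega> w \<noteq> replicate K 0 \<Longrightarrow> state \<omega> w \<in> set (Q_indices K)"
  by (auto simp: set_Q_indices state_def)

text \<open>An edge of length \<open>k i\<close> into a child of \<open>w\<close> starts at the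
  ancestor \<open>k i - 1\<close> generations above \<open>w\<close>, which the state of
  \<open>w\<close> records at position \<open>K - k i\<close>. Hence the state of \<open>w\<close>
  contains all of the past that matters.\<close>

lemma reach_snoc_iff:
  assumes "w @ [a] \<in> T"
  shows "reach \<omega> [] (w @ [a]) \<longleftrightarrow> (\<exists>i\<in>{1..m}. k i \<le> Suc (length w) \<and>
     state \<omega> w ! (K - k i) = 1 \<and> \<omega> (i, take (Suc (length w) - k i) w, w @ [a]))"
proof -
  have "(k i \<le> length (w @ [a]) \<and> reach \<omega> [] (take (length (w @ [a]) - k i) (w @ [a])) \<and>
          \<omega> (i, take (length (w @ [a]) - k i) (w @ [a]), w @ [a])) \<longleftrightarrow>
        (k i \<le> Suc (length w) \<and> state \<omega> w ! (K - k i) = 1 \<and>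
          \<omega> (i, take (Suc (length w) - k i) w, w @ [a]))"
    if "i \<in> {1..m}" for i
  proof -
    have ki: "k i \<ge> 1" "k i \<le> K" using that k_ge_1 k_le_K by auto
    then have t: "take (Suc (length w) - k i) (w @ [a]) = take (Suc (length w) - k i) w" by simp
    have "K - 1 - (K - k i) = k i - 1" "K - k i < K" using ki by auto
    then have "state \<omega> w ! (K - k i) = of_bool (k i - 1 \<le> length w \<and> reach \<omega> [] (take (length w - (k i - 1)) w))"
      by (simp only: state_nth)
    moreover have "length w - (k i - 1) = Suc (length w) - k i" using ki by simp
    ultimately have "k i \<le> Suc (length w) \<Longrightarrow>
        state \<omega> w ! (K - k i) = 1 \<longleftrightarrow> reach \<omega> [] (take (Suc (length w) - k i) w)"
      using ki by auto
    then show ?thesis unfolding length_append_singleton t by blast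
  qed
  then show ?thesis
    by (subst reach_last_step[OF assms]) (simp, intro bex_cong refl)
qed

text \<open>The Markov property. Given \<open>state \<omega> w = x\<close>, all entries of the next
  state but the last are shifted copies, and the last one is 0 iff the edges into the new vertex
  from reached ancestors are closed. Those edges are independent of the state of \<open>w\<close>,
  which involves only edges ending at prefixes of \<open>w\<close>.\<close>

lemma state_transition:
  assumes w: "w @ [a] \<in> T" and x: "x \<in> set (Q_indices K)" and y: "y \<in> set (Q_indices K)"
  shows "\<P>(\<omega> in N. state \<omega> w = x \<and> state \<omega> (w @ [a]) = y) =
         \<P>(\<omega> in N. state \<omega> w = x) * Q_entry m k p x y"
proof (cases "\<forall>i\<in>{1..<K}. y ! (i - 1) = x ! i")
  \<comment> \<open>Without the shift relation between \<open>x\<close> and \<open>y\<close> both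
    sides vanish.\<close>
  case False
  then obtain i where i: "i \<in> {1..<K}" "y ! (i - 1) \<noteq> x ! i" by blast
  have "\<not> (state \<omega> w = x \<and> state \<omega> (w @ [a]) = y)" for \<omega>
    using state_snoc_nth[of "i - Suc 0" \<omega> w a, OF diff_less_mono] i by auto
  then have "{\<omega> \<in> space N. state \<omega> w = x \<and> state \<omega> (w @ [a]) = y} = {}" by blast
  moreover have "Q_entry m k p x y = 0"
    unfolding Q_entry_def Let_def by (simp only: False if_False)
  ultimately show ?thesis by (simp only: measure_empty mult_zero_right)
next
  case True
  have len: "length x = K" "length y = K" using x y by (auto simp: set_Q_indices)
  have x01: "x ! j \<in> {0, 1}" and y01: "y ! j \<in> {0, 1}" if "j < K" for j
  proof -
    have "x ! j \<in> set x" "y ! j \<in> set y" using that len by simp_all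
    then show "x ! j \<in> {0, 1}" "y ! j \<in> {0, 1}" using x y unfolding set_Q_indices by blast+
  qed
  have lt: "K - k i < K" if "i \<in> {1..m}" for i
    using k_ge_1[OF that] K_ge_1 by simp
  \<comment> \<open>These index the edges into the new vertex whose starting point is recorded as
    reached by \<open>x\<close>.\<close>
  define S where "S = {i \<in> {1..m}. x ! (K - k i) = 1}"
  show ?thesis
  proof (cases "\<exists>i\<in>S. k i > Suc (length w)")
    \<comment> \<open>Such an edge would start above the root, where the state always records 0. So
      \<open>x\<close> is impossible and both sides are 0.\<close>
    case True
    then obtain i where i: "i \<in> {1..m}" "x ! (K - k i) = 1" "k i > Suc (length w)"
      by (auto simp: S_def)
    have "state \<omega> w ! (K - k i) = 0" for \<omega>
      using i k_le_K[OF i(1)] by (subst state_nth) auto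
    then have "state \<omega> w \<noteq> x" for \<omega> using i(2) by (metis zero_neq_one)
    then show ?thesis by simp
  next
    case False
    define e where "e i = (i, take (Suc (length w) - k i) w, w @ [a])" for i
    have eE: "e ` S \<subseteq> E"
    proof (rule image_subsetI)
      fix i assume "i \<in> S"
      with False have "i \<in> {1..m}" "k i \<le> Suc (length w)" by (auto simp: S_def not_less)
      then show "e i \<in> E" using k_ge_1[of i] by (simp add: e_def edges_iff_take[OF w])
    qed
    have e_meas: "Measurable.pred N (\<lambda>\<omega>. \<forall>e\<in>e ` S. \<not> \<omega> e)"
      using eE by (intro pred_intros_finite pred_intros_logic pred_edge) (auto simp: S_def)
    have y_iff: "state \<omega> (w @ [a]) = y \<longleftrightarrow> ((y ! (K - 1) = 0) \<longleftrightarrow> (\<forall>e\<in>e ` S. \<not> \<omega> e))" if st: "state \<omega> w = x" for \<omega>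
    proof -
      have "state \<omega> (w @ [a]) = y \<longleftrightarrow> state \<omega> (w @ [a]) ! (K - 1) = y ! (K - 1)"
      proof
        assume l: "state \<omega> (w @ [a]) ! (K - 1) = y ! (K - 1)"
        show "state \<omega> (w @ [a]) = y"
        proof (rule nth_equalityI)
          fix j assume "j < length (state \<omega> (w @ [a]))"
          then consider "j = K - 1" | "j < K - 1" by fastforce
          then show "state \<omega> (w @ [a]) ! j = y ! j"
          proof cases
            case 2
            with \<open>\<forall>i\<in>{1..<K}. y ! (i - 1) = x ! i\<close>[rule_format, of "Suc j"]
            show ?thesis by (simp add: state_snoc_nth st)
          qed (use l in simp)
        qed (simp add: len)
      qed simp
      also have "\<dots> \<longleftrightarrow> ((y ! (K - 1) = 0) \<longleftrightarrow> \<not> reach \<omega> [] (w @ [a]))"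
        using y01[of "K - 1"] K_ge_1 by (auto simp: state_last)
      also have "reach \<omega> [] (w @ [a]) \<longleftrightarrow> \<not> (\<forall>e\<in>e ` S. \<not> \<omega> e)"
        unfolding reach_snoc_iff[OF w] st e_def using False by (auto simp: S_def not_less)
      finally show ?thesis by simp
    qed
    define q where "q = (\<Prod>i\<in>S. 1 - p i)"
    have inj: "inj_on e S" by (auto simp: e_def inj_on_def)
    have "finite S" by (simp add: S_def)
    moreover have "(\<Prod>(i, u, v)\<in>e ` S. 1 - p i) = q"
      by (simp add: prod.reindex[OF inj] q_def) (simp add: e_def)
    ultimately have q: "\<P>(\<omega> in N. \<forall>e\<in>e ` S. \<not> \<omega> e) = q"
      using prob_all_closed[OF finite_imageI eE] by simp
    \<comment> \<open>Indices outside \<open>S\<close> contribute a zeroth power, so the product in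
      \<open>Q_entry\<close> is the probability that all relevant edges are closed.\<close>
    have "(\<Prod>j = 1..m. (1 - p j) ^ (x ! (K - k j))) = (\<Prod>j\<in>S. (1 - p j) ^ (x ! (K - k j)))"
    proof (intro prod.mono_neutral_right ballI)
      fix i assume "i \<in> {1..m} - S"
      then have "x ! (K - k i) = 0" using x01[OF lt[of i]] by (auto simp: S_def)
      then show "(1 - p i) ^ (x ! (K - k i)) = 1" by simp
    qed (auto simp: S_def)
    also have "\<dots> = q" unfolding q_def by (rule prod.cong) (auto simp: S_def)
    finally have Q: "Q_entry m k p x y = (if y ! (K - 1) = 0 then q else 1 - q)"
      unfolding Q_entry_def Let_def using \<open>\<forall>i\<in>{1..<K}. y ! (i - 1) = x ! i\<close> by simp
    have "\<P>(\<omega> in N. state \<omega> w = x \<and> state \<omega> (w @ [a]) = y) =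
        \<P>(\<omega> in N. state \<omega> w = x \<and> ((y ! (K - 1) = 0) \<longleftrightarrow> (\<forall>e\<in>e ` S. \<not> \<omega> e)))"
      by (intro arg_cong[where f = "measure N"] Collect_cong conj_cong refl y_iff)
    also have "\<dots> = \<P>(\<omega> in N. state \<omega> w = x) * \<P>(\<omega> in N. (y ! (K - 1) = 0) \<longleftrightarrow> (\<forall>e\<in>e ` S. \<not> \<omega> e))"
    proof (rule prob_conj_disjoint_edges[of "{(i, u, v) \<in> E. prefix v w}" "e ` S"])
      show "{(i, u, v) \<in> E. prefix v w} \<inter> e ` S = {}"
        by (auto simp: e_def dest: prefix_length_le)
      show "Measurable.pred N (\<lambda>\<omega>. (y ! (K - 1) = 0) \<longleftrightarrow> (\<forall>e\<in>e ` S. \<not> \<omega> e))"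
        using e_meas by measurable
      show "state \<omega>' w = x"
        if eq: "\<And>e. e \<in> {(i, u, v) \<in> E. prefix v w} \<Longrightarrow> \<omega> e = \<omega>' e" and "state \<omega> w = x" for \<omega> \<omega>'
      proof -
        have "reach \<omega> [] (take n w) \<longleftrightarrow> reach \<omega>' [] (take n w)" for n
          by (rule iffI; erule reach_cong)
             (use eq take_is_prefix[of n w] prefix_order.trans in \<open>blast+\<close>)
        then have "state \<omega> w = state \<omega>' w" by (simp add: state_def)
        with that(2) show ?thesis by simp
      qed
      show "((y ! (K - 1) = 0) \<longleftrightarrow> (\<forall>e\<in>e ` S. \<not> \<omega>' e))"
        if "\<And>e'. e' \<in> e ` S \<Longrightarrow> \<omega> e' = \<omega>' e'" "(y ! (K - 1) = 0) \<longleftrightarrow> (\<forall>e\<in>e ` S. \<not> \<omega> e)" for \<omega> \<omega>'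
        using that by simp
    qed (use eE in auto)
    also have "\<P>(\<omega> in N. (y ! (K - 1) = 0) \<longleftrightarrow> (\<forall>e\<in>e ` S. \<not> \<omega> e)) = Q_entry m k p x y"
    proof (cases "y ! (K - 1) = 0")
      case True
      then show ?thesis by (simp add: Q q[simplified])
    next
      case False
      have "\<P>(\<omega> in N. \<not> (\<forall>e\<in>e ` S. \<not> \<omega> e)) = 1 - \<P>(\<omega> in N. \<forall>e\<in>e ` S. \<not> \<omega> e)"
        by (rule N.prob_neg) (use e_meas in \<open>simp add: pred_def\<close>)
      then show ?thesis unfolding q using False by (simp add: Q)
    qed
    finally show ?thesis .
  qed
qed

text \<open>By induction along the ray to \<open>w\<close>: the event is split according to the
  state of the parent, and \<open>state_transition\<close> evaluates each piece.\<close>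

lemma prob_state:
  assumes "w \<in> T" "y \<in> set (Q_indices K)"
  shows "\<P>(\<omega> in N. state \<omega> w = y) = occ m k p (length w) y"
  using assms
proof (induction w arbitrary: y rule: rev_induct)
  case Nil
  have "\<P>(\<omega> in N. state \<omega> [] = y) = of_bool (y = replicate (K - 1) 0 @ [1])"
    by (auto simp: state_Nil N.prob_space)
  then show ?case by simp
next
  case (snoc a w)
  then have w: "w \<in> T" by (simp add: T_iff)
  \<comment> \<open>The zero state is absorbing: edges have length at most \<open>K\<close>, so when
    none of the last \<open>K\<close> vertices of the ray is reached, neither is the next one. Hence
    the sum over earlier states may omit it.\<close>
  have dead: "state \<omega> w \<in> set (Q_indices K)" if st: "state \<omega> (w @ [a]) = y" for \<omega>
  proof (rule state_in_indices, rule notI)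
    assume z: "state \<omega> w = replicate K 0"
    have z': "state \<omega> w ! j = 0" if "j < K" for j
      using that by (simp add: z)
    have "state \<omega> (w @ [a]) = replicate K 0"
    proof (rule nth_equalityI)
      fix j assume "j < length (state \<omega> (w @ [a]))"
      then consider "j = K - 1" | "j < K - 1" by fastforce
      then have "state \<omega> (w @ [a]) ! j = 0"
      proof cases
        case 1
        have "\<not> reach \<omega> [] (w @ [a])"
          unfolding reach_snoc_iff[OF snoc.prems(1)] using z' k_ge_1 K_ge_1 by fastforce
        with 1 show ?thesis by (simp add: state_last)
      qed (simp add: state_snoc_nth z')
      with \<open>j < _\<close> show "state \<omega> (w @ [a]) ! j = replicate K 0 ! j" by simp
    qed simp
    with st snoc.prems(2) show False by (simp add: set_Q_indices)
  qed
  have "{\<omega> \<in> space N. state \<omega> (w @ [a]) = y} =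
      (\<Union>x\<in>set (Q_indices K). {\<omega> \<in> space N. state \<omega> w = x \<and> state \<omega> (w @ [a]) = y})"
    using dead by auto
  then have "\<P>(\<omega> in N. state \<omega> (w @ [a]) = y) =
      (\<Sum>x\<in>set (Q_indices K). \<P>(\<omega> in N. state \<omega> w = x \<and> state \<omega> (w @ [a]) = y))"
    by (simp only:) (rule N.finite_measure_finite_Union, auto simp: disjoint_family_on_def)
  also have "\<dots> = (\<Sum>x\<in>set (Q_indices K). occ m k p (length w) x * Q_entry m k p x y)"
    using snoc w by (intro sum.cong) (auto simp: state_transition)
  finally show ?case by simp
qed

text \<open>\<open>w\<close> is reached iff the last entry of its state is 1. Such a state is
  nonzero, so it is among the states summed in \<open>conn\<close>.\<close>

lemma prob_reach:
  assumes w: "w \<in> T"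
  shows "\<P>(\<omega> in N. reach \<omega> [] w) = conn m k p (length w)"
proof -
  let ?Y = "{y \<in> set (Q_indices K). y ! (K - 1) = 1}"
  have "state \<omega> w \<in> set (Q_indices K)" if "reach \<omega> [] w" for \<omega>
    using that state_last[of \<omega> w] K_ge_1 by (intro state_in_indices notI) simp
  then have "{\<omega> \<in> space N. reach \<omega> [] w} = (\<Union>y\<in>?Y. {\<omega> \<in> space N. state \<omega> w = y})"
    by (auto simp: state_last of_bool_def split: if_splits)
  then have "\<P>(\<omega> in N. reach \<omega> [] w) = (\<Sum>y\<in>?Y. \<P>(\<omega> in N. state \<omega> w = y))"
    by (simp only:) (rule N.finite_measure_finite_Union, auto simp: disjoint_family_on_def)
  also have "\<dots> = conn m k p (length w)"
    unfolding conn_def using w by (intro sum.cong) (auto simp: prob_state)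
  finally show ?thesis .
qed

end

section \<open>Criteria for percolation\<close>

context long_range_percolation
begin

definition level :: "nat \<Rightarrow> nat list set" where
  "level n = {w \<in> T. length w = n}"

lemma finite_level: "finite (level n)" and card_level: "card (level n) = d ^ n"
proof -
  have "level n = {w. set w \<subseteq> {..<d} \<and> length w = n}" by (auto simp: level_def T_iff)
  then show "finite (level n)" "card (level n) = d ^ n"
    by (simp_all add: finite_lists_length_eq card_lists_length_eq)
qed

lemma levelD: "w \<in> level n \<Longrightarrow> w \<in> T" "w \<in> level n \<Longrightarrow> length w = n"
  by (simp_all add: level_def)

lemma zeros_level: "replicate n 0 \<in> level n"
  using d_ge_2 by (auto simp: level_def T_iff)

lemma Nil_T [simp]: "[] \<in> T"
  by (simp add: T_iff)

lemma cluster_eq: "cluster d m k \<omega> v = {w. reach \<omega> v w}"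
  by (simp add: cluster_def reach_def)

lemma pred_infinite_cluster [measurable]: "Measurable.pred N (\<lambda>\<omega>. infinite (cluster d m k \<omega> []))"
  using infinite_cluster_measurable by (simp add: pred_def)

lemma theta_eq: "\<theta> d m k p = \<P>(\<omega> in N. infinite (cluster d m k \<omega> []))"
  by (simp add: \<theta>_def)

section \<open>Upper bound by window sums\<close>

text \<open>Every open path from the root to a depth beyond \<open>n\<close> has a vertex in the
  levels \<open>n + 1\<close> to \<open>n + K\<close>. If all reached vertices there had finite
  clusters in their subtrees, the cluster of the root would be covered by the finitely many words of
  length at most \<open>n\<close> and finitely many finite sets.\<close>

lemma infinite_cluster_window:
  assumes "infinite (cluster d m k \<omega> [])"
  shows "\<exists>j\<in>{1..K}. \<exists>v\<in>level (n + j). reach \<omega> [] v \<and> infinite (cluster d m k (tree_shift v \<omega>) [])"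
proof (rule ccontr)
  assume neg: "\<not> ?thesis"
  let ?W = "\<Union>j\<in>{1..K}. {v \<in> level (n + j). reach \<omega> [] v}"
  have "cluster d m k \<omega> [] \<subseteq> {w. set w \<subseteq> {..<d} \<and> length w \<le> n} \<union>
          (\<Union>v\<in>?W. (@) v ` cluster d m k (tree_shift v \<omega>) [])"
  proof
    fix w assume "w \<in> cluster d m k \<omega> []"
    then have w: "reach \<omega> [] w" by (simp add: cluster_eq)
    then have wT: "w \<in> T" by (rule reach_T) simp
    show "w \<in> {w. set w \<subseteq> {..<d} \<and> length w \<le> n} \<union>
          (\<Union>v\<in>?W. (@) v ` cluster d m k (tree_shift v \<omega>) [])"
    proof (cases "length w \<le> n")
      case True
      with wT show ?thesis by (simp add: T_iff)
    next
      case False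
      then obtain v where v: "reach \<omega> [] v" "reach \<omega> v w" "n < length v" "length v \<le> n + K"
        using reach_window[OF w, of n] by auto
      have vT: "v \<in> T" using v(1) by (rule reach_T) simp
      obtain u where u: "w = v @ u" using reach_prefix[OF v(2)] by (auto simp: prefix_def)
      have "reach (tree_shift v \<omega>) [] u" using v(2) by (simp add: reach_tree_shift vT u)
      moreover have "v \<in> ?W"
        using v vT by (auto simp: level_def intro!: bexI[of _ "length v - n"])
      ultimately show ?thesis using u by (auto simp: cluster_eq)
    qed
  qed
  moreover have "finite ({w. set w \<subseteq> {..<d} \<and> length w \<le> n} \<union>
          (\<Union>v\<in>?W. (@) v ` cluster d m k (tree_shift v \<omega>) []))"
    using neg finite_level by (intro finite_UnI finite_lists_length_le finite_UN_I finite_imageI) auto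
  ultimately show False using assms finite_subset by blast
qed

text \<open>A union bound over the vertices of the window. For each \<open>v\<close>, being reached
  is independent of having an infinite cluster in its subtree, which by translation invariance has
  probability \<open>\<theta> d m k p\<close>.\<close>

lemma theta_le_window:
  "\<theta> d m k p \<le> (\<Sum>j = 1..K. real d ^ (n + j) * conn m k p (n + j)) * \<theta> d m k p"
proof -
  let ?A = "\<lambda>v. {\<omega> \<in> space N. reach \<omega> [] v \<and> infinite (cluster d m k (tree_shift v \<omega>) [])}"
  have sets: "?A v \<in> sets N" if "v \<in> level l" for v l
    using levelD(1)[OF that] by measurable
  have UN_sets: "(\<Union>v\<in>level l. ?A v) \<in> sets N" for l
    using sets finite_level by (intro sets.finite_UN) auto
  have "\<theta> d m k p \<le> measure N (\<Union>j\<in>{1..K}. \<Union>v\<in>level (n + j). ?A v)"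
    unfolding theta_eq
  proof (rule N.finite_measure_mono)
    show "{\<omega> \<in> space N. infinite (cluster d m k \<omega> [])} \<subseteq> (\<Union>j\<in>{1..K}. \<Union>v\<in>level (n + j). ?A v)"
      using infinite_cluster_window[of _ n] by blast
    show "(\<Union>j\<in>{1..K}. \<Union>v\<in>level (n + j). ?A v) \<in> sets N"
      by (rule sets.finite_UN[OF _ UN_sets]) simp
  qed
  also have "\<dots> \<le> (\<Sum>j = 1..K. measure N (\<Union>v\<in>level (n + j). ?A v))"
    using UN_sets by (intro N.finite_measure_subadditive_finite) auto
  also have "\<dots> \<le> (\<Sum>j = 1..K. \<Sum>v\<in>level (n + j). measure N (?A v))"
    using sets finite_level by (intro sum_mono N.finite_measure_subadditive_finite) auto
  also have "\<dots> = (\<Sum>j = 1..K. \<Sum>v\<in>level (n + j). conn m k p (n + j) * \<theta> d m k p)"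
  proof (intro sum.cong refl)
    fix j v assume "v \<in> level (n + j)"
    then have v: "v \<in> T" "length v = n + j" by (auto dest: levelD)
    show "measure N (?A v) = conn m k p (n + j) * \<theta> d m k p"
      using prob_reach_tree_shift[OF v(1) pred_infinite_cluster] by (simp add: prob_reach v theta_eq)
  qed
  also have "\<dots> = (\<Sum>j = 1..K. real d ^ (n + j) * conn m k p (n + j)) * \<theta> d m k p"
    by (simp add: card_level sum_distrib_left mult_ac)
  finally show ?thesis .
qed

lemma theta_0_if_window_less_1:
  assumes "(\<Sum>j = 1..K. real d ^ (n + j) * conn m k p (n + j)) < 1"
  shows "\<theta> d m k p = 0"
proof (rule ccontr)
  assume "\<theta> d m k p \<noteq> 0"
  then have "\<theta> d m k p > 0" by (simp add: \<theta>_def zero_less_measure_iff)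
  with assms have "(\<Sum>j = 1..K. real d ^ (n + j) * conn m k p (n + j)) * \<theta> d m k p < 1 * \<theta> d m k p"
    by (rule mult_strict_right_mono)
  with theta_le_window[of n] show False by simp
qed

section \<open>Lower bound by the second moment\<close>

text \<open>An approximation of the infinite cluster event that decreases in \<open>L\<close>. Long
  edges may jump over level \<open>L\<close>, hence depth at least \<open>L\<close> rather than
  exactly \<open>L\<close>.\<close>

definition reaches_depth :: "nat \<Rightarrow> (nat \<times> nat list \<times> nat list \<Rightarrow> bool) \<Rightarrow> bool" where
  "reaches_depth L \<omega> \<longleftrightarrow> (\<exists>w. reach \<omega> [] w \<and> L \<le> length w)"

lemma pred_reaches_depth [measurable]: "Measurable.pred N (reaches_depth L)"
proof -
  have "Measurable.pred N (\<lambda>\<omega>. \<exists>w. reach \<omega> [] w \<and> L \<le> length w)" by measurable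
  then show ?thesis by (simp add: reaches_depth_def[abs_def])
qed

lemma reaches_depth_antimono: "L \<le> L' \<Longrightarrow> reaches_depth L' \<omega> \<Longrightarrow> reaches_depth L \<omega>"
  unfolding reaches_depth_def using le_trans by blast

lemma reaches_depth_add:
  assumes "v \<in> level n" "reach \<omega> [] v" "reaches_depth L (tree_shift v \<omega>)"
  shows "reaches_depth (L + n) \<omega>"
proof -
  from assms(3) obtain u where u: "reach (tree_shift v \<omega>) [] u" "L \<le> length u"
    by (auto simp: reaches_depth_def)
  have "reach \<omega> v (v @ u)" using u(1) levelD(1)[OF assms(1)] by (simp add: reach_tree_shift)
  with assms(2) have "reach \<omega> [] (v @ u)" by (rule reach_trans)
  with u(2) levelD(2)[OF assms(1)] show ?thesis by (auto simp: reaches_depth_def)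
qed

text \<open>Only finitely many vertices lie above any given depth, so an infinite cluster is an
  unbounded one.\<close>

lemma infinite_cluster_iff: "infinite (cluster d m k \<omega> []) \<longleftrightarrow> (\<forall>L. reaches_depth L \<omega>)"
proof
  assume inf: "infinite (cluster d m k \<omega> [])"
  show "\<forall>L. reaches_depth L \<omega>"
  proof (rule allI, rule ccontr)
    fix L assume "\<not> reaches_depth L \<omega>"
    then have "cluster d m k \<omega> [] \<subseteq> {w. set w \<subseteq> {..<d} \<and> length w \<le> L}"
      using reach_T[of \<omega> "[]"] by (fastforce simp: cluster_eq reaches_depth_def T_iff not_le)
    with inf show False using finite_lists_length_le[of "{..<d}" L] finite_subset by blast
  qed
next
  assume all: "\<forall>L. reaches_depth L \<omega>"
  show "infinite (cluster d m k \<omega> [])"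
  proof
    assume fin: "finite (cluster d m k \<omega> [])"
    from all obtain w where w: "reach \<omega> [] w" "Suc (Max (length ` cluster d m k \<omega> [])) \<le> length w"
      by (auto simp: reaches_depth_def)
    then have "length w \<le> Max (length ` cluster d m k \<omega> [])"
      using fin by (intro Max_ge) (auto simp: cluster_eq)
    with w(2) show False by simp
  qed
qed

lemma prob_reaches_depth_tendsto: "(\<lambda>L. \<P>(\<omega> in N. reaches_depth L \<omega>)) \<longlonglongrightarrow> \<theta> d m k p"
proof -
  let ?A = "\<lambda>L. {\<omega> \<in> space N. reaches_depth L \<omega>}"
  have "(\<lambda>L. measure N (?A L)) \<longlonglongrightarrow> measure N (\<Inter>L. ?A L)"
    by (rule N.finite_Lim_measure_decseq) (auto simp: decseq_def intro: reaches_depth_antimono)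
  moreover have "(\<Inter>L. ?A L) = {\<omega> \<in> space N. infinite (cluster d m k \<omega> [])}"
    by (auto simp: infinite_cluster_iff)
  ultimately show ?thesis by (simp add: theta_eq)
qed

text \<open>
  A second moment argument: if \<open>r L\<close> is the probability of reaching depth \<open>L\<close> and \<open>b > 1\<close> the mean
  number of reached vertices at depth \<open>n\<close>, then \<open>r L \<ge> r (L + n) \<ge> b r L - d\<^sup>2\<^sup>n (r L)\<^sup>2\<close>, which keeps
  \<open>r L\<close> away from 0.
\<close>

lemma theta_pos_if_mean_gt_1:
  assumes n: "n \<ge> 1" and gt: "real d ^ n * conn m k p n > 1"
  shows "\<theta> d m k p > 0"
proof -
  define r where "r L = \<P>(\<omega> in N. reaches_depth L \<omega>)" for L
  let ?A = "\<lambda>L v. {\<omega> \<in> space N. reach \<omega> [] v \<and> reaches_depth L (tree_shift v \<omega>)}"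
  have r_mono: "r L' \<le> r L" if "L \<le> L'" for L L'
    unfolding r_def using reaches_depth_antimono[OF that] by (intro N.finite_measure_mono) auto
  have A_sets: "?A L v \<in> sets N" if "v \<in> level n" for L v
    using levelD(1)[OF that] by measurable
  have A_prob: "measure N (?A L v) = conn m k p n * r L" if "v \<in> level n" for L v
    using prob_reach_tree_shift[OF levelD(1)[OF that] pred_reaches_depth] levelD[OF that]
    by (simp add: prob_reach r_def)
  have A_UN: "measure N (\<Union>v\<in>V. ?A L v) \<le> r (L + n)" if "V \<subseteq> level n" for L V
    unfolding r_def using that reaches_depth_add by (intro N.finite_measure_mono) auto
  have conn_pos: "conn m k p n > 0"
    using gt d_ge_2 by (smt (verit) mult_nonneg_nonpos zero_le_power of_nat_0_le_iff)
  \<comment> \<open>Continuing through the vertex \<open>replicate n 0\<close> loses at most the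
    factor \<open>conn m k p n > 0\<close> per \<open>n\<close> levels. Positivity allows cancelling
    \<open>r L\<close> below.\<close>
  have r_pos: "r L > 0" for L
  proof -
    have "r (j * n) > 0" for j
    proof (induction j)
      case 0
      have "reaches_depth 0 \<omega>" for \<omega> by (auto simp: reaches_depth_def intro: exI[of _ "[]"])
      then show ?case by (simp add: r_def N.prob_space)
    next
      case (Suc j)
      have "0 < conn m k p n * r (j * n)" using Suc conn_pos by simp
      also have "\<dots> \<le> r (j * n + n)"
        using A_UN[of "{replicate n 0}" "j * n"] zeros_level by (simp add: A_prob)
      finally show ?case by (simp add: add.commute)
    qed
    from this[of L] r_mono[of L "L * n"] n show ?thesis by (simp add: order_less_le_trans)
  qed
  define b where "b = real d ^ n * conn m k p n"
  have "(b - 1) / real (d ^ n) ^ 2 \<le> r L" for L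
  proof -
    have "real (d ^ n) * (conn m k p n * r L) = (\<Sum>v\<in>level n. measure N (?A L v))"
      by (simp add: A_prob card_level)
    also have "\<dots> \<le> measure N (\<Union>v\<in>level n. ?A L v) + real (card (level n)) ^ 2 * r L ^ 2"
    proof (rule N.bonferroni_lower[OF finite_level])
      fix v w assume vw: "v \<in> level n" "w \<in> level n" "v \<noteq> w"
      note vw' = levelD[OF vw(1)] levelD[OF vw(2)]
      \<comment> \<open>Dropping the condition that \<open>v\<close> and \<open>w\<close> are
        reached leaves two events in disjoint subtrees, whose joint probability factorizes.\<close>
      have "measure N (?A L v \<inter> ?A L w) \<le>
          \<P>(\<omega> in N. reaches_depth L (tree_shift v \<omega>) \<and> reaches_depth L (tree_shift w \<omega>))"
      proof (rule N.finite_measure_mono)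
        show "{\<omega> \<in> space N. reaches_depth L (tree_shift v \<omega>) \<and> reaches_depth L (tree_shift w \<omega>)} \<in> sets N"
          using vw'(1,3) by measurable
      qed auto
      also have "\<dots> = r L ^ 2"
        unfolding r_def using vw vw' by (intro prob_two_tree_shifts) auto
      finally show "measure N (?A L v \<inter> ?A L w) \<le> r L ^ 2" .
    qed (use A_sets in auto)
    also have "\<dots> \<le> r L + real (d ^ n) ^ 2 * r L ^ 2"
      using A_UN[of "level n" L] r_mono[of L "L + n"] by (simp add: card_level)
    finally have "b * r L \<le> (1 + real (d ^ n) ^ 2 * r L) * r L"
      by (simp add: b_def algebra_simps power2_eq_square)
    then have "b \<le> 1 + real (d ^ n) ^ 2 * r L"
      using r_pos[of L] by (simp only: mult_le_cancel_right_pos)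
    then show ?thesis using d_ge_2 by (simp add: pos_divide_le_eq mult.commute)
  qed
  then have "(b - 1) / real (d ^ n) ^ 2 \<le> \<theta> d m k p"
    using prob_reaches_depth_tendsto unfolding r_def[symmetric] by (intro LIMSEQ_le_const) auto
  moreover have "(b - 1) / real (d ^ n) ^ 2 > 0"
    using gt d_ge_2 by (simp add: b_def)
  ultimately show ?thesis by linarith
qed

text \<open>The single edge of length \<open>k i\<close> from the root already connects it to a
  vertex at depth \<open>k i\<close>.\<close>

lemma p_le_conn:
  assumes i: "i \<in> {1..m}"
  shows "p i \<le> conn m k p (k i)"
proof -
  define w where "w = replicate (k i) (0::nat)"
  have w: "w \<in> T" "length w = k i" using levelD[OF zeros_level[of "k i"]] by (auto simp: w_def)
  have e: "(i, [], w) \<in> E" using i w by (simp add: edges_iff_take)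
  have "\<P>(\<omega> in N. \<omega> (i, [], w)) = 1 - \<P>(\<omega> in N. \<not> \<omega> (i, [], w))"
    using N.prob_neg[of "\<lambda>\<omega>. \<not> \<omega> (i, [], w)"] e by simp
  also have "\<P>(\<omega> in N. \<not> \<omega> (i, [], w)) = 1 - p i"
    using prob_all_closed[of "{(i, [], w)}"] e by simp
  finally have "p i = \<P>(\<omega> in N. \<omega> (i, [], w))" by simp
  also have "\<dots> \<le> \<P>(\<omega> in N. reach \<omega> [] w)"
  proof (rule N.finite_measure_mono)
    show "{\<omega> \<in> space N. \<omega> (i, [], w)} \<subseteq> {\<omega> \<in> space N. reach \<omega> [] w}"
      using e by (auto simp: reach_def open_step_def intro!: r_into_rtrancl)
  qed simp
  also have "\<dots> = conn m k p (k i)" using w by (simp add: prob_reach)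
  finally show ?thesis .
qed

section \<open>Decay of the means when \<open>1 / d\<close> is not an eigenvalue\<close>

lemma occ_nonneg:
  assumes "y \<in> set (Q_indices K)"
  shows "occ m k p n y \<ge> 0"
proof -
  have "occ m k p (length (replicate n (0::nat))) y \<ge> 0"
    by (subst prob_state[OF levelD(1)[OF zeros_level] assms, symmetric]) (rule measure_nonneg)
  then show ?thesis by simp
qed

text \<open>A nonzero state \<open>y\<close> has an entry 1, say at \<open>j\<close>, and
  \<open>state \<omega> w = y\<close> then forces the ancestor \<open>g = K - 1 - j\<close>
  generations above \<open>w\<close> to be reached. That has probability
  \<open>conn m k p (n - g)\<close>, and scaling it by \<open>d^n\<close> rather than
  \<open>d^(n - g)\<close> costs the factor \<open>d^g\<close>, at most \<open>d^K\<close>.\<close>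

lemma scaled_occ_le:
  assumes y: "y \<in> set (Q_indices K)" and mean: "\<And>n. n \<ge> 1 \<Longrightarrow> real d ^ n * conn m k p n \<le> 1"
  shows "real d ^ n * occ m k p n y \<le> real d ^ K"
proof -
  have y': "length y = K" "set y \<subseteq> {0, 1}" "y \<noteq> replicate K 0" using y by (auto simp: set_Q_indices)
  have "\<exists>j<K. y ! j \<noteq> 0"
  proof (rule ccontr)
    assume "\<not> ?thesis"
    then have "y = replicate K 0" by (intro nth_equalityI) (simp_all add: y'(1))
    with y'(3) show False ..
  qed
  then obtain j where j: "j < K" "y ! j \<noteq> 0" by blast
  then have "y ! j \<in> set y" using y'(1) by simp
  from subsetD[OF y'(2) this] have "y ! j = 0 \<or> y ! j = 1" by simp
  with j(2) have yj: "y ! j = 1" by metis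
  define g where "g = K - 1 - j"
  define w where "w = replicate n (0::nat)"
  have w: "w \<in> T" "length w = n" unfolding w_def by (fact levelD[OF zeros_level])+
  have st: "g \<le> n \<and> reach \<omega> [] (take (n - g) w)" if "state \<omega> w = y" for \<omega>
  proof -
    have "of_bool (g \<le> length w \<and> reach \<omega> [] (take (length w - g) w)) = (1 :: nat)"
      unfolding g_def state_nth[OF j(1), symmetric] that yj ..
    then show ?thesis unfolding of_bool_eq_1_iff w(2) .
  qed
  \<comment> \<open>Depth 0 is needed when the recorded ancestor is the root itself, which is always
    reached.\<close>
  have mean': "real d ^ l * conn m k p l \<le> 1" for l
  proof (cases "l = 0")
    case True
    have "conn m k p 0 = \<P>(\<omega> in N. reach \<omega> [] [])" by (subst prob_reach) auto
    then show ?thesis using True by simp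
  qed (use mean in auto)
  show ?thesis
  proof (cases "g \<le> n")
    case True
    have tw: "take (n - g) w \<in> T" "length (take (n - g) w) = n - g"
      using levelD[OF zeros_level[of "n - g"]] True by (auto simp: w_def min_def)
    have "occ m k p n y = \<P>(\<omega> in N. state \<omega> w = y)" using prob_state[OF w(1) y] w by simp
    also have "\<dots> \<le> \<P>(\<omega> in N. reach \<omega> [] (take (n - g) w))"
      using st by (intro N.finite_measure_mono) auto
    also have "\<dots> = conn m k p (n - g)" using tw by (simp add: prob_reach)
    finally have "real d ^ n * occ m k p n y \<le> real d ^ n * conn m k p (n - g)"
      using d_ge_2 by (intro mult_left_mono) auto
    also have "\<dots> = real d ^ (g + (n - g)) * conn m k p (n - g)" using True by simp
    also have "\<dots> = real d ^ g * (real d ^ (n - g) * conn m k p (n - g))" by (simp only: power_add mult.assoc)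
    also have "\<dots> \<le> real d ^ g * 1"
      using mean'[of "n - g"] d_ge_2 by (intro mult_left_mono) auto
    also have "\<dots> \<le> real d ^ K * 1"
      using d_ge_2 by (intro mult_right_mono power_increasing) (auto simp: g_def)
    finally show ?thesis by simp
  next
    \<comment> \<open>The recorded ancestor would lie above the root, so \<open>y\<close> cannot
      occur at depth \<open>n\<close>.\<close>
    case False
    then have "{\<omega> \<in> space N. state \<omega> w = y} = {}" using st by auto
    then have "\<P>(\<omega> in N. state \<omega> w = y) = 0" by (simp only: measure_empty)
    then show ?thesis using prob_state[OF w(1) y] w(2) by simp
  qed
qed

text \<open>The vectors \<open>v n = d^n * occ m k p n\<close> satisfy
  \<open>v (n + 1) / d = v n * Q\<close> and are bounded by \<open>d^K\<close>, so
  \<open>bounded_orbit_tendsto_0\<close> with \<open>c = 1 / d\<close> makes them tend to 0. The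
  mean is a sum of some of their finitely many entries.\<close>

lemma mean_tendsto_0:
  assumes mean: "\<And>n. n \<ge> 1 \<Longrightarrow> real d ^ n * conn m k p n \<le> 1"
    and nonroot: "poly (char_poly (Q_matrix m k p)) (1 / real d) \<noteq> 0"
  shows "(\<lambda>n. real d ^ n * conn m k p n) \<longlonglongrightarrow> 0"
proof -
  define I where "I = Q_indices K"
  have Qm: "Q_matrix m k p \<in> carrier_mat (length I) (length I)"
    by (simp add: Q_matrix_def I_def Let_def)
  have set_I: "set I = (!) I ` {..<length I}" and inj_I: "inj_on ((!) I) {..<length I}"
    using distinct_Q_indices[of K] by (auto simp: set_conv_nth I_def intro: inj_on_nth)
  have lim: "(\<lambda>n. real d ^ n * occ m k p n (I ! i)) \<longlonglongrightarrow> 0" if i: "i < length I" for i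
  proof (rule bounded_orbit_tendsto_0[OF Qm nonroot _ _ _ i])
    fix t i assume i: "i < length I"
    then have Ii: "I ! i \<in> set (Q_indices K)" by (simp add: I_def)
    show "real d ^ t * occ m k p t (I ! i) \<ge> 0" using occ_nonneg[OF Ii] by simp
    show "real d ^ t * occ m k p t (I ! i) \<le> real d ^ K" by (rule scaled_occ_le[OF Ii mean])
    have "occ m k p (Suc t) (I ! i) = (\<Sum>x\<in>set I. occ m k p t x * Q_entry m k p x (I ! i))"
      by (simp add: I_def)
    also have "\<dots> = (\<Sum>j<length I. occ m k p t (I ! j) * Q_entry m k p (I ! j) (I ! i))"
      unfolding set_I by (subst sum.reindex[OF inj_I]) simp
    also have "\<dots> = (\<Sum>j<length I. occ m k p t (I ! j) * Q_matrix m k p $$ (j, i))"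
      using i by (intro sum.cong) (simp_all add: Q_matrix_def I_def Let_def)
    finally show "1 / real d * (real d ^ Suc t * occ m k p (Suc t) (I ! i)) =
        (\<Sum>j<length I. real d ^ t * occ m k p t (I ! j) * Q_matrix m k p $$ (j, i))"
      using d_ge_2 by (simp add: sum_distrib_left mult_ac)
  qed
  have "(\<lambda>n. \<Sum>y\<in>{y \<in> set I. y ! (K - 1) = 1}. real d ^ n * occ m k p n y) \<longlonglongrightarrow>
      (\<Sum>y\<in>{y \<in> set I. y ! (K - 1) = 1}. 0)"
    using lim by (intro tendsto_sum) (auto simp: in_set_conv_nth)
  then show ?thesis by (simp add: conn_def I_def sum_distrib_left)
qed

end

section \<open>The critical surface\<close>

text \<open>The case distinctions in \<open>Q_entry\<close> involve only \<open>x\<close> and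
  \<open>y\<close>, so for fixed states the entry is a polynomial in the parameters.\<close>

lemma continuous_map_Q_entry:
  "continuous_map (parameter_cube m) euclideanreal (\<lambda>p. Q_entry m k p x y)"
proof -
  have p: "continuous_map (parameter_cube m) euclideanreal (\<lambda>p. p j)" if "j \<in> {1..m}" for j
  proof -
    note continuous_map_product_projection[OF that, of "\<lambda>_. top_of_set {0..1::real}"]
    then have "continuous_map (parameter_cube m) (top_of_set {0..1}) (\<lambda>p. p j)"
      unfolding parameter_cube_def .
    then show ?thesis by (rule continuous_map_into_fulltopology)
  qed
  have q: "continuous_map (parameter_cube m) euclideanreal (\<lambda>p. \<Prod>j = 1..m. (1 - p j) ^ (x ! (k m - k j)))"
  proof (rule continuous_map_prod)
    fix j assume j: "j \<in> {1..m}"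
    show "continuous_map (parameter_cube m) euclideanreal (\<lambda>p. (1 - p j) ^ (x ! (k m - k j)))"
      by (rule continuous_map_real_pow[OF continuous_map_diff[OF _ p[OF j]]]) simp
  qed simp
  have q': "continuous_map (parameter_cube m) euclideanreal (\<lambda>p. 1 - (\<Prod>j = 1..m. (1 - p j) ^ (x ! (k m - k j))))"
    by (rule continuous_map_diff[OF _ q]) simp
  from q q' show ?thesis
    unfolding Q_entry_def Let_def by (auto simp del: prod_eq_1_iff)
qed

lemma continuous_map_occ:
  "continuous_map (parameter_cube m) euclideanreal (\<lambda>p. occ m k p n y)"
proof (induction n arbitrary: y)
  case (Suc n)
  have "continuous_map (parameter_cube m) euclideanreal
      (\<lambda>p. \<Sum>x\<in>set (Q_indices (k m)). occ m k p n x * Q_entry m k p x y)"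
    by (rule continuous_map_sum[OF _ continuous_map_real_mult[OF Suc.IH continuous_map_Q_entry]]) simp
  then show ?case by simp
qed simp

lemma continuous_map_conn:
  "continuous_map (parameter_cube m) euclideanreal (\<lambda>p. conn m k p n)"
  unfolding conn_def by (rule continuous_map_sum[OF _ continuous_map_occ]) simp

theorem theorem1:
  fixes d m :: nat and k :: "nat \<Rightarrow> nat"
  assumes "d \<ge> 2" and "m \<ge> 1"
    and "k 1 \<ge> 1" and "strict_mono_on {1..m} k"
    and "Gcd (k ` {1..m}) = 1"
  shows "critical_surface d m k \<subseteq>
    {p \<in> PiE {1..m} (\<lambda>i. {0..1 / real d ^ k i}).
       poly (char_poly (Q_matrix m k p)) (1 / real d) = 0}"
proof
  let ?X = "parameter_cube m"
  let ?S = "{p \<in> topspace ?X. \<theta> d m k p > 0}"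
  have perc: "long_range_percolation d m k p" if "p \<in> topspace ?X" for p
    using assms that by unfold_locales (auto simp: parameter_cube_def)
  fix p assume "p \<in> critical_surface d m k"
  then have cl: "p \<in> ?X closure_of ?S" "p \<in> ?X closure_of (topspace ?X - ?S)"
    by (auto simp: critical_surface_def frontier_of_closures)
  then have pX: "p \<in> topspace ?X" by (simp add: in_closure_of)
  interpret long_range_percolation d m k p by (rule perc[OF pX])
  have near: "\<exists>q\<in>?S. q \<in> U" "\<exists>q\<in>topspace ?X - ?S. q \<in> U" if "openin ?X U" "p \<in> U" for U
    using cl that unfolding in_closure_of by blast+
  have cont: "continuous_map ?X euclideanreal (\<lambda>q. real d ^ n * conn m k q n)" for n
    by (rule continuous_map_real_mult_left[OF continuous_map_conn])
  have mean: "real d ^ n * conn m k p n \<le> 1" if n: "n \<ge> 1" for n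
  proof (rule ccontr)
    assume "\<not> ?thesis"
    \<comment> \<open>There are points without percolation in every neighbourhood of
      \<open>p\<close>, whereas a mean above 1 persists on the open set \<open>?U\<close> and forces
      percolation.\<close>
    let ?U = "{q \<in> topspace ?X. real d ^ n * conn m k q n \<in> {1<..}}"
    have "openin ?X ?U"
      by (rule openin_continuous_map_preimage[OF cont]) simp
    moreover have "p \<in> ?U" using pX \<open>\<not> _\<close> by simp
    ultimately obtain q where "q \<in> topspace ?X - ?S" "q \<in> ?U"
      using near(2)[of ?U] by blast
    then have q: "q \<in> topspace ?X" "\<not> \<theta> d m k q > 0" "real d ^ n * conn m k q n > 1" by simp_all
    then show False using long_range_percolation.theta_pos_if_mean_gt_1[OF perc[OF q(1)] n] by blast
  qed
  have window: "(\<Sum>j = 1..K. real d ^ (n + j) * conn m k p (n + j)) \<ge> 1" for n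
  proof (rule ccontr)
    assume "\<not> ?thesis"
    \<comment> \<open>Symmetrically, points with percolation lie in every neighbourhood of
      \<open>p\<close>, whereas a window sum below 1 persists nearby and excludes
      percolation.\<close>
    let ?U = "{q \<in> topspace ?X. (\<Sum>j = 1..K. real d ^ (n + j) * conn m k q (n + j)) \<in> {..<1}}"
    have "openin ?X ?U"
      by (rule openin_continuous_map_preimage[OF continuous_map_sum[OF _ cont]]) simp_all
    moreover have "p \<in> ?U" using pX \<open>\<not> _\<close> by simp
    ultimately obtain q where "q \<in> ?S" "q \<in> ?U"
      using near(1)[of ?U] by blast
    then have q: "q \<in> topspace ?X" "\<theta> d m k q > 0"
        "(\<Sum>j = 1..K. real d ^ (n + j) * conn m k q (n + j)) < 1" by simp_all
    then show False using long_range_percolation.theta_0_if_window_less_1[OF perc[OF q(1)] q(3)] by simp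
  qed
  have "poly (char_poly (Q_matrix m k p)) (1 / real d) = 0"
  proof (rule ccontr)
    assume "poly (char_poly (Q_matrix m k p)) (1 / real d) \<noteq> 0"
    from mean_tendsto_0[OF mean this] have lim: "(\<lambda>n. real d ^ n * conn m k p n) \<longlonglongrightarrow> 0" .
    \<comment> \<open>The window has a fixed number of terms, each tending to 0, yet its sum stays
      at least 1.\<close>
    have "(\<lambda>n. \<Sum>j = 1..K. real d ^ (n + j) * conn m k p (n + j)) \<longlonglongrightarrow> (\<Sum>j = 1..K. 0)"
      by (intro tendsto_sum LIMSEQ_ignore_initial_segment[OF lim])
    then have "1 \<le> (\<Sum>j = 1..K. 0 :: real)"
      using window by (intro LIMSEQ_le_const) auto
    then show False by simp
  qed
  moreover have "p \<in> PiE {1..m} (\<lambda>i. {0..1 / real d ^ k i})"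
  proof
    fix i assume i: "i \<in> {1..m}"
    \<comment> \<open>The bound on \<open>p i\<close> is the bound on the mean at depth
      \<open>k i\<close>, to which the direct edges from the root contribute.\<close>
    have "real d ^ k i * p i \<le> real d ^ k i * conn m k p (k i)"
      using p_le_conn[OF i] by (intro mult_left_mono) auto
    also have "\<dots> \<le> 1" using mean k_ge_1[OF i] by simp
    finally show "p i \<in> {0..1 / real d ^ k i}"
      using p_01[OF i] d_ge_2 by (simp add: pos_le_divide_eq mult.commute)
  next
    show "p i = undefined" if "i \<notin> {1..m}" for i
      using pX that by (auto simp: parameter_cube_def)
  qed
  ultimately show "p \<in> {p \<in> PiE {1..m} (\<lambda>i. {0..1 / real d ^ k i}).
       poly (char_poly (Q_matrix m k p)) (1 / real d) = 0}" by simp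
qed

end
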